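(* The state evolution map $\Psi_{\lambda_*,1}(\sigma^2)$ of $\ell_1$-AMP with the optimal thresholding policy has a unique stable fixed point. Furthermore, in the noiseless setting $\sigma_w=0$ and for every $p_X\in\mathcal{F}_\epsilon$ (the set of distributions whose mass at zero is greater than or equal to $1-\epsilon$, i.e. $P(X\neq0)\le\epsilon$ for $X\sim p_X$), $0$ is the unique stable fixed point of $\Psi_{\lambda_*,1}(\sigma^2)$ if and only if $$\delta>M_1(\epsilon),$$ where $$M_1(\epsilon)=\inf_{\tau\ge0}\sup_{\mu\ge0}\left[(1-\epsilon)\mathbb{E}(\eta_1(Z;\tau))^2+\epsilon\,\mathbb{E}(\eta_1(\mu+Z;\tau)-\mu)^2\right],\quad Z\sim N(0,1),$$ can be simplified to $$M_1(\epsilon)=\inf_{\tau\ge0}\ (1-\epsilon)\mathbb{E}(\eta_1^2(Z;\tau))+\epsilon(1+\tau^2).$$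
   Context: Soft thresholding: $\eta_1(u;\lambda)=(|u|-\lambda)\,\mathrm{sign}(u)\,\mathbb{I}(|u|>\lambda)$ for $\lambda\ge0$. $\delta\in(0,1)$ is the undersampling ratio, $\sigma_w\ge0$ the noise level, and the signal distribution $p_X\in\mathcal{F}_\epsilon$ is assumed to have finite second moment. State evolution map with optimal thresholding policy $\lambda_*(\sigma)\in\arg\min_{\lambda}\mathbb{E}|\eta_1(X+\sigma Z;\lambda)-X|^2$: for $\sigma\ge0$, $$\Psi_{\lambda_*,1}(\sigma^2)=\sigma_w^2+\frac1\delta\,\mathbb{E}\left|\eta_1(X+\sigma Z;\lambda_*(\sigma))-X\right|^2,$$ with $X\sim p_X$ and $Z\sim N(0,1)$ independent. Stable fixed point: $\sigma_f$ is a stable fixed point of $\Psi$ if and only if $\Psi(\sigma_f^2)=\sigma_f^2$ and there is an open interval $I\ni\sigma_f$ such that $\Psi(\sigma^2)<\sigma^2$ for all $\sigma>\sigma_f$ in $I$ and $\Psi(\sigma^2)>\sigma^2$ for all $\sigma<\sigma_f$ in $I$. Zero is a stable fixed point if and only if $\Psi(0)=0$ and there is $\sigma_i>0$ with $\Psi(\sigma^2)<\sigma^2$ for all $0<\sigma<\sigma_i$.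
   Formalization: The "if and only if δ > M₁(ε)" is stated only for δ ≠ M₁(ε), because at δ = M₁(ε) zero is still the unique stable fixed point for every p_X having an optimal policy; the point mass at 0 has no optimal policy, so nothing is claimed for it. *)

theory Defs
  imports "HOL-Probability.Probability"
begin

definition soft_threshold :: "real \<Rightarrow> real \<Rightarrow> real" where
  "soft_threshold u l = (\<bar>u\<bar> - l) * sgn u * indicator {v. \<bar>v\<bar> > l} u"

definition sparse_dists :: "real \<Rightarrow> real measure set" where
  "sparse_dists \<epsilon> = {p. real_distribution p \<and> measure p {0} \<ge> 1 - \<epsilon>}"

definition finite_second_moment :: "real measure \<Rightarrow> bool" where
  "finite_second_moment p \<longleftrightarrow> integrable p (\<lambda>x. x\<^sup>2)"

(* Independence of the signal X and the noise Z is expressed by the product measure. *)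
definition risk :: "real measure \<Rightarrow> real \<Rightarrow> real \<Rightarrow> real" where
  "risk p \<sigma> l =
     (\<integral>(x, z). \<bar>soft_threshold (x + \<sigma> * z) l - x\<bar>\<^sup>2 \<partial>(p \<Otimes>\<^sub>M std_normal_distribution))"

(* A minimizing threshold need not be unique, so a policy is any selection of minimizers.
   If p is the point mass at 0, then no real threshold is optimal for \<sigma> > 0 (the infimum 0
   is only approached as the threshold tends to infinity), so no optimal policy exists. *)
definition optimal_policy :: "real measure \<Rightarrow> (real \<Rightarrow> real) \<Rightarrow> bool" where
  "optimal_policy p lam \<longleftrightarrow> (\<forall>\<sigma>\<ge>0. is_arg_min (risk p \<sigma>) (\<lambda>l. l \<ge> 0) (lam \<sigma>))"

(* The argument v is the variance \<sigma>\<^sup>2, whereas the policy lam takes \<sigma>. *)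
definition state_evolution ::
  "real measure \<Rightarrow> real \<Rightarrow> real \<Rightarrow> (real \<Rightarrow> real) \<Rightarrow> real \<Rightarrow> real" where
  "state_evolution p \<sigma>w \<delta> lam v = \<sigma>w\<^sup>2 + 1 / \<delta> * risk p (sqrt v) (lam (sqrt v))"

(* The point s is on the scale of the standard deviation \<sigma>, while \<Psi> acts on variances.
   Only \<sigma> \<ge> 0 is meaningful, and 0 is treated by a one-sided condition. *)
definition stable_fixed_point :: "(real \<Rightarrow> real) \<Rightarrow> real \<Rightarrow> bool" where
  "stable_fixed_point \<Psi> s \<longleftrightarrow>
     (if s = 0 then \<Psi> 0 = 0 \<and> (\<exists>\<sigma>i>0. \<forall>\<sigma>. 0 < \<sigma> \<and> \<sigma> < \<sigma>i \<longrightarrow> \<Psi> (\<sigma>\<^sup>2) < \<sigma>\<^sup>2)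
      else s > 0 \<and> \<Psi> (s\<^sup>2) = s\<^sup>2 \<and>
        (\<exists>a b. s \<in> {a<..<b} \<and>
           (\<forall>\<sigma>\<in>{a<..<b}. \<sigma> \<ge> 0 \<longrightarrow>
              (\<sigma> > s \<longrightarrow> \<Psi> (\<sigma>\<^sup>2) < \<sigma>\<^sup>2) \<and> (\<sigma> < s \<longrightarrow> \<Psi> (\<sigma>\<^sup>2) > \<sigma>\<^sup>2))))"

definition M1 :: "real \<Rightarrow> real" where
  "M1 \<epsilon> = (INF \<tau>\<in>{0..}. SUP \<mu>\<in>{0..}.
      (1 - \<epsilon>) * (\<integral>z. (soft_threshold z \<tau>)\<^sup>2 \<partial>std_normal_distribution) +
      \<epsilon> * (\<integral>z. (soft_threshold (\<mu> + z) \<tau> - \<mu>)\<^sup>2 \<partial>std_normal_distribution))"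

end

theory Submission
  imports Defs
begin

text \<open>After rescaling by \<open>\<sigma>\<close>, the risk divided by \<open>\<sigma>\<^sup>2\<close> is the average over \<open>x\<close> of the risk of
  \<open>x / \<sigma> + Z\<close> with threshold \<open>\<lambda> / \<sigma>\<close>, and the squared error increases with the modulus
  of the signal. Hence the minimal risk divided by \<open>\<sigma>\<^sup>2\<close> decreases in \<open>\<sigma>\<close>, strictly wherever it
  is below 1, so \<open>\<Psi>(\<sigma>\<^sup>2) / \<sigma>\<^sup>2\<close> crosses 1 at most once, from above. In the noiseless case zero is
  stable iff there is no crossing. As the risk increases to \<open>1 + \<tau>\<^sup>2\<close> when the signal
  grows, the minimal ratio never exceeds \<open>M1 \<epsilon>\<close>, and the two-point signal with mass \<open>\<epsilon>\<close> at 1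
  approaches \<open>M1 \<epsilon>\<close> as \<open>\<sigma>\<close> tends to 0. For that signal an optimal threshold exists because
  for large thresholds the risk approaches its limit from below.\<close>

subsection \<open>The soft thresholding error\<close>

text \<open>This form is piecewise linear and continuous in both arguments: bounds become case
  splits on \<open>max\<close>, and limits follow by continuity. The sign condition on
  \<open>l\<close> keeps the two positive parts from overlapping.\<close>

lemma soft_threshold_eq:
  "0 \<le> l \<Longrightarrow> soft_threshold u l = max (u - l) 0 - max (- u - l) 0"
  by (auto simp: soft_threshold_def indicator_def sgn_real_def)

lemma borel_measurable_soft_threshold [measurable]:
  assumes [measurable]: "f \<in> borel_measurable M"
  shows "(\<lambda>x. soft_threshold (f x) l) \<in> borel_measurable M"
proof -
  have "(\<lambda>u::real. soft_threshold u l) \<in> borel_measurable borel"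
    unfolding soft_threshold_def by measurable
  then show ?thesis by (rule measurable_compose[OF assms])
qed

lemma soft_threshold_scale:
  assumes "0 < s" shows "soft_threshold (s * u) (s * l) = s * soft_threshold u l"
proof -
  have "\<bar>s * u\<bar> > s * l \<longleftrightarrow> \<bar>u\<bar> > l"
    using assms by (simp add: abs_mult)
  then show ?thesis
    using assms by (simp add: soft_threshold_def indicator_def abs_mult sgn_mult algebra_simps)
qed

lemma soft_threshold_minus: "soft_threshold (- u) l = - soft_threshold u l"
  by (simp add: soft_threshold_def sgn_minus indicator_def)

lemma soft_threshold_zero [simp]: "soft_threshold u 0 = u"
  by (simp add: soft_threshold_eq)

text \<open>Thresholding never increases the modulus, and it moves its argument by at most
  \<open>l\<close>. The first bound dominates limits in the threshold, the second limits in the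
  signal.\<close>

lemma soft_error_le:
  assumes "0 \<le> l"
  shows "\<bar>soft_threshold (x + w) l - x\<bar> \<le> 2 * \<bar>x\<bar> + \<bar>w\<bar>"
    and "\<bar>soft_threshold (x + w) l - x\<bar> \<le> l + \<bar>w\<bar>"
  using assms by (auto simp: soft_threshold_eq max_def)

lemma soft_error_sq_le:
  assumes "0 \<le> l"
  shows "(soft_threshold (x + w) l - x)\<^sup>2 \<le> 8 * x\<^sup>2 + 2 * w\<^sup>2"
    and "(soft_threshold (x + w) l - x)\<^sup>2 \<le> 2 * l\<^sup>2 + 2 * w\<^sup>2"
proof -
  have *: "(a + \<bar>w\<bar>)\<^sup>2 \<le> 2 * a\<^sup>2 + 2 * w\<^sup>2" for a :: real
    using sum_squares_bound[of a "\<bar>w\<bar>"] by (simp add: power2_sum)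
  show "(soft_threshold (x + w) l - x)\<^sup>2 \<le> 8 * x\<^sup>2 + 2 * w\<^sup>2"
    using power_mono[OF soft_error_le(1)[OF assms, of x w], of 2] *[of "2 * \<bar>x\<bar>"]
    by (simp add: power_mult_distrib)
  show "(soft_threshold (x + w) l - x)\<^sup>2 \<le> 2 * l\<^sup>2 + 2 * w\<^sup>2"
    using power_mono[OF soft_error_le(2)[OF assms, of x w], of 2] *[of l]
    by simp
qed

text \<open>As a function of \<open>m \<ge> 0\<close>, the squared error is continuous with derivative
  \<open>2 * m\<close> where \<open>\<bar>m + z\<bar> \<le> l\<close> and derivative 0 elsewhere.\<close>

lemma soft_error_mono_nonneg:
  assumes "0 \<le> l" "0 \<le> m" "m \<le> n"
  shows "(soft_threshold (m + z) l - m)\<^sup>2 \<le> (soft_threshold (n + z) l - n)\<^sup>2"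
    and "m < n \<Longrightarrow> \<bar>n + z\<bar> < l \<Longrightarrow>
      (soft_threshold (m + z) l - m)\<^sup>2 < (soft_threshold (n + z) l - n)\<^sup>2"
proof -
  have "\<bar>soft_threshold (m + z) l - m\<bar> \<le> \<bar>soft_threshold (n + z) l - n\<bar>"
    using assms by (auto simp: soft_threshold_eq max_def split: if_splits)
  then show "(soft_threshold (m + z) l - m)\<^sup>2 \<le> (soft_threshold (n + z) l - n)\<^sup>2"
    by (simp add: abs_le_square_iff)
  assume "m < n" "\<bar>n + z\<bar> < l"
  then have "\<bar>soft_threshold (m + z) l - m\<bar> < \<bar>soft_threshold (n + z) l - n\<bar>"
    using assms by (auto simp: soft_threshold_eq max_def split: if_splits)
  then show "(soft_threshold (m + z) l - m)\<^sup>2 < (soft_threshold (n + z) l - n)\<^sup>2"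
    by (metis abs_le_square_iff not_le)
qed

text \<open>The factors \<open>a\<close> and \<open>b\<close> play the role of
  \<open>1 / \<sigma>\<close>. Soft thresholding is odd, so flipping the signs of \<open>x\<close>
  and \<open>z\<close> together reduces negative signals to positive ones.\<close>

lemma soft_error_mono:
  assumes "0 \<le> l" "0 \<le> a" "a \<le> b"
  shows "(soft_threshold (a * x + z) l - a * x)\<^sup>2 \<le> (soft_threshold (b * x + z) l - b * x)\<^sup>2"
    and "a < b \<Longrightarrow> x \<noteq> 0 \<Longrightarrow> \<bar>b * x + z\<bar> < l \<Longrightarrow>
      (soft_threshold (a * x + z) l - a * x)\<^sup>2 < (soft_threshold (b * x + z) l - b * x)\<^sup>2"
proof -
  have neg: "(soft_threshold (c * x + z) l - c * x)\<^sup>2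
      = (soft_threshold (c * (- x) + (- z)) l - c * (- x))\<^sup>2" for c
    using soft_threshold_minus[of "c * x + z" l] by (simp add: power2_commute)
  show "(soft_threshold (a * x + z) l - a * x)\<^sup>2 \<le> (soft_threshold (b * x + z) l - b * x)\<^sup>2"
  proof (cases "x \<ge> 0")
    case True
    then show ?thesis using assms by (intro soft_error_mono_nonneg mult_right_mono) auto
  next
    case False
    then show ?thesis using assms unfolding neg
      by (intro soft_error_mono_nonneg mult_right_mono) (auto intro: mult_nonneg_nonpos)
  qed
  assume *: "a < b" "x \<noteq> 0" "\<bar>b * x + z\<bar> < l"
  show "(soft_threshold (a * x + z) l - a * x)\<^sup>2 < (soft_threshold (b * x + z) l - b * x)\<^sup>2"
  proof (cases "x \<ge> 0")
    case True
    then show ?thesis using assms * by (intro soft_error_mono_nonneg mult_right_mono) auto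
  next
    case False
    have "\<bar>b * (- x) + (- z)\<bar> < l" using * by simp
    then show ?thesis using assms * False unfolding neg
      by (intro soft_error_mono_nonneg mult_right_mono) (auto simp: mult_less_cancel_right mult_nonneg_nonpos)
  qed
qed

subsection \<open>The risk for a Gaussian shifted by a constant\<close>

abbreviation "\<N> \<equiv> std_normal_distribution"

interpretation gauss: real_distribution \<N>
  by (rule real_dist_normal_dist)

lemma gauss_integrable_sq [simp]: "integrable \<N> (\<lambda>z. z\<^sup>2)"
  by (rule integrable_std_normal_distribution_moment)

lemma gauss_integral_sq [simp]: "(\<integral>z. z\<^sup>2 \<partial>\<N>) = 1"
  using std_normal_distribution_even_moments[of 1] by simp

lemma gauss_integrable_id [simp]: "integrable \<N> (\<lambda>z. z)"
  using integrable_std_normal_distribution_moment[of 1] by simp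

lemma gauss_integral_id [simp]: "(\<integral>z. z \<partial>\<N>) = 0"
  using integral_std_normal_distribution_moment_odd[of 1] by simp

text \<open>The classical risk of soft thresholding for a Gaussian mean \<open>m\<close> with unit
  variance; both integrals in \<open>M1\<close> are instances.\<close>

definition shift_risk :: "real \<Rightarrow> real \<Rightarrow> real" where
  "shift_risk m t = (\<integral>z. (soft_threshold (m + z) t - m)\<^sup>2 \<partial>\<N>)"

lemma integrable_soft_error [simp]:
  assumes "0 \<le> t" shows "integrable \<N> (\<lambda>z. (soft_threshold (m + c * z) t - m)\<^sup>2)"
proof (rule Bochner_Integration.integrable_bound)
  show "integrable \<N> (\<lambda>z. 8 * m\<^sup>2 + 2 * (c\<^sup>2 * z\<^sup>2))" by simp
  show "AE z in \<N>. norm ((soft_threshold (m + c * z) t - m)\<^sup>2) \<le> norm (8 * m\<^sup>2 + 2 * (c\<^sup>2 * z\<^sup>2))"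
    using soft_error_sq_le(1)[OF assms, of m "c * _"] by (intro AE_I2) (simp add: power_mult_distrib)
qed simp

lemma integrable_soft_error1 [simp]:
  assumes "0 \<le> t" shows "integrable \<N> (\<lambda>z. (soft_threshold (m + z) t - m)\<^sup>2)"
  using integrable_soft_error[OF assms, of m 1] by simp

lemma shift_risk_nonneg [simp]: "0 \<le> shift_risk m t"
  unfolding shift_risk_def by (rule Bochner_Integration.integral_nonneg) simp

lemma shift_risk_mono:
  assumes "0 \<le> t" "0 \<le> a" "a \<le> b"
  shows "shift_risk (a * x) t \<le> shift_risk (b * x) t"
  unfolding shift_risk_def using assms
  by (intro integral_mono soft_error_mono(1)) auto

text \<open>The Gaussian density vanishes nowhere. Strict inequalities between integrals rest on
  this.\<close>

lemma gauss_interval_pos: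
  assumes "a < b" shows "emeasure \<N> {a<..<b} \<noteq> 0"
proof
  assume "emeasure \<N> {a<..<b} = 0"
  then have "{a<..<b} \<in> null_sets \<N>" by auto
  then have "AE x in lborel. x \<in> {a<..<b} \<longrightarrow> std_normal_density x = 0"
    by (subst (asm) null_sets_density_iff) (auto simp: ennreal_eq_0_iff normal_density_nonneg order_antisym)
  moreover have "std_normal_density x \<noteq> 0" for x
    using normal_density_pos[of 1 0 x] by simp
  ultimately have "AE x in lborel. x \<notin> {a<..<b}" by auto
  then have "emeasure lborel {a<..<b} = 0"
    by (subst (asm) AE_iff_measurable[of "{a<..<b}"]) auto
  then show False using assms by simp
qed

text \<open>The errors differ strictly where the larger signal is cut to zero, an interval of length
  \<open>2 * t\<close> in \<open>z\<close>. At threshold 0 the risk is constantly 1 and strictness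
  fails.\<close>

lemma shift_risk_strict_mono:
  assumes "0 < t" "0 \<le> a" "a < b" "x \<noteq> 0"
  shows "shift_risk (a * x) t < shift_risk (b * x) t"
  unfolding shift_risk_def
proof (rule gauss.integral_less_AE)
  show "emeasure \<N> {- (b * x) - t <..< - (b * x) + t} \<noteq> 0"
    using assms by (intro gauss_interval_pos) simp
  show "AE z in \<N>. z \<in> {- (b * x) - t <..< - (b * x) + t} \<longrightarrow>
      (soft_threshold (a * x + z) t - a * x)\<^sup>2 \<noteq> (soft_threshold (b * x + z) t - b * x)\<^sup>2"
  proof (rule AE_I2, rule impI)
    fix z assume "z \<in> {- (b * x) - t <..< - (b * x) + t}"
    then have "\<bar>b * x + z\<bar> < t" by auto
    then show "(soft_threshold (a * x + z) t - a * x)\<^sup>2 \<noteq> (soft_threshold (b * x + z) t - b * x)\<^sup>2"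
      using soft_error_mono(2)[of t a b x z] assms by simp
  qed
qed (use assms in \<open>auto intro!: soft_error_mono(1)\<close>)

text \<open>Noise above the threshold survives with positive probability. This rules out an optimal
  policy for the point mass at 0.\<close>

lemma shift_risk_zero_pos:
  assumes "0 \<le> t" shows "0 < shift_risk 0 t"
proof -
  have "(\<integral>z. 0 \<partial>\<N>) < shift_risk 0 t"
    unfolding shift_risk_def
  proof (rule gauss.integral_less_AE)
    show "emeasure \<N> {t<..<t + 1} \<noteq> 0"
      by (rule gauss_interval_pos) simp
    show "AE z in \<N>. z \<in> {t<..<t + 1} \<longrightarrow> 0 \<noteq> (soft_threshold (0 + z) t - 0)\<^sup>2"
      using assms by (intro AE_I2) (auto simp: soft_threshold_eq max_def)
  qed (use integrable_soft_error1[OF assms, of 0] in auto)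
  then show ?thesis by simp
qed

text \<open>A large signal passes the threshold from above, so that the error becomes
  \<open>z - t\<close>, whose second moment is \<open>1 + t\<^sup>2\<close>.\<close>

lemma shift_risk_tendsto:
  assumes "0 \<le> t" shows "(\<lambda>n. shift_risk (real n) t) \<longlonglongrightarrow> 1 + t\<^sup>2"
proof -
  have "(\<lambda>n. shift_risk (real n) t) \<longlonglongrightarrow> (\<integral>z. (z - t)\<^sup>2 \<partial>\<N>)"
    unfolding shift_risk_def
  proof (rule integral_dominated_convergence[where w = "\<lambda>z. 2 * t\<^sup>2 + 2 * z\<^sup>2"])
    show "AE z in \<N>. (\<lambda>n. (soft_threshold (real n + z) t - real n)\<^sup>2) \<longlonglongrightarrow> (z - t)\<^sup>2"
    proof (rule AE_I2, rule tendsto_eventually)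
      fix z :: real
      have "\<forall>\<^sub>F n in sequentially. real n > \<bar>z\<bar> + t"
        using filterlim_real_sequentially unfolding filterlim_at_top_dense by blast
      then show "\<forall>\<^sub>F n in sequentially. (soft_threshold (real n + z) t - real n)\<^sup>2 = (z - t)\<^sup>2"
        by eventually_elim (use assms in \<open>auto simp: soft_threshold_eq max_def\<close>)
    qed
  qed (use soft_error_sq_le(2)[OF assms] in auto)
  also have "(\<integral>z. (z - t)\<^sup>2 \<partial>\<N>) = (\<integral>z. z\<^sup>2 + t\<^sup>2 - 2 * t * z \<partial>\<N>)"
    by (simp add: power2_diff algebra_simps)
  also have "\<dots> = 1 + t\<^sup>2"
    using gauss.prob_space by (simp add: measure_def)
  finally show ?thesis .
qed

lemma gauss_integral_minus:
  fixes f :: "real \<Rightarrow> real"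
  assumes [measurable]: "f \<in> borel_measurable borel"
  shows "(\<integral>z. f (- z) \<partial>\<N>) = (\<integral>z. f z \<partial>\<N>)"
proof -
  have "(\<integral>z. f z \<partial>\<N>) = (\<integral>z. std_normal_density z * f z \<partial>lborel)"
    by (subst integral_density) auto
  also have "\<dots> = (\<integral>z. std_normal_density (- z) * f (- z) \<partial>lborel)"
    by (subst lborel_integral_real_affine[of "-1" _ 0]) auto
  also have "\<dots> = (\<integral>z. f (- z) \<partial>\<N>)"
    by (subst integral_density) (auto simp: normal_density_def)
  finally show ?thesis by simp
qed

lemma shift_risk_minus: "shift_risk (- m) t = shift_risk m t"
proof -
  have "(soft_threshold (- m - z) t + m)\<^sup>2 = (soft_threshold (m + z) t - m)\<^sup>2" for z
    using soft_threshold_minus[of "m + z" t] by (simp add: power2_commute)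
  then show ?thesis
    using gauss_integral_minus[of "\<lambda>z. (soft_threshold (- m + z) t - - m)\<^sup>2"]
    by (simp add: shift_risk_def)
qed

text \<open>The risk is even in \<open>m\<close> and increases for \<open>m \<ge> 0\<close>, so its
  limit at infinity is an upper bound.\<close>

lemma shift_risk_le:
  assumes "0 \<le> t" shows "shift_risk m t \<le> 1 + t\<^sup>2"
proof -
  have "shift_risk \<bar>m\<bar> t \<le> 1 + t\<^sup>2"
  proof (rule LIMSEQ_le_const[OF shift_risk_tendsto[OF assms]])
    show "\<exists>N. \<forall>n\<ge>N. shift_risk \<bar>m\<bar> t \<le> shift_risk (real n) t"
    proof (intro exI allI impI)
      fix n assume "n \<ge> nat \<lceil>\<bar>m\<bar>\<rceil>"
      then have "\<bar>m\<bar> \<le> real n" by linarith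
      then show "shift_risk \<bar>m\<bar> t \<le> shift_risk (real n) t"
        using shift_risk_mono[of t "\<bar>m\<bar>" "real n" 1] assms by simp
    qed
  qed
  then show ?thesis
    by (cases "m \<ge> 0") (use shift_risk_minus in \<open>auto simp: abs_if\<close>)
qed

lemma shift_risk_zero_right [simp]: "shift_risk m 0 = 1"
  by (simp add: shift_risk_def)

lemma shift_risk_tendsto_threshold:
  assumes "\<And>n. 0 \<le> t n" "t \<longlonglongrightarrow> t0"
  shows "(\<lambda>n. shift_risk m (t n)) \<longlonglongrightarrow> shift_risk m t0"
proof -
  have t0: "0 \<le> t0" using LIMSEQ_le_const[OF assms(2)] assms(1) by blast
  show ?thesis unfolding shift_risk_def
  proof (rule integral_dominated_convergence[where w = "\<lambda>z. 8 * m\<^sup>2 + 2 * z\<^sup>2"])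
    show "AE z in \<N>. (\<lambda>n. (soft_threshold (m + z) (t n) - m)\<^sup>2)
        \<longlonglongrightarrow> (soft_threshold (m + z) t0 - m)\<^sup>2"
      unfolding soft_threshold_eq[OF assms(1)] soft_threshold_eq[OF t0]
      by (intro AE_I2 tendsto_intros assms)
  qed (use soft_error_sq_le(1)[OF assms(1)] in auto)
qed

lemma shift_risk_tendsto_top:
  "((\<lambda>t. shift_risk m t) \<longlongrightarrow> m\<^sup>2) at_top"
proof -
  have "((\<lambda>t. shift_risk m t) \<longlongrightarrow> (\<integral>z. m\<^sup>2 \<partial>\<N>)) at_top"
    unfolding shift_risk_def
  proof (rule integral_dominated_convergence_at_top[where w = "\<lambda>z. 8 * m\<^sup>2 + 2 * z\<^sup>2"])
    show "AE z in \<N>. ((\<lambda>t. (soft_threshold (m + z) t - m)\<^sup>2) \<longlongrightarrow> m\<^sup>2) at_top"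
    proof (rule AE_I2, rule tendsto_eventually)
      fix z :: real
      show "\<forall>\<^sub>F t in at_top. (soft_threshold (m + z) t - m)\<^sup>2 = m\<^sup>2"
        using eventually_gt_at_top[of "\<bar>m + z\<bar>"]
        by eventually_elim (simp add: soft_threshold_def)
    qed
    show "\<forall>\<^sub>F t in at_top. AE z in \<N>. norm ((soft_threshold (m + z) t - m)\<^sup>2) \<le> 8 * m\<^sup>2 + 2 * z\<^sup>2"
      using eventually_ge_at_top[of 0]
      by eventually_elim (use soft_error_sq_le(1) in auto)
  qed auto
  then show ?thesis
    using gauss.prob_space by (simp add: measure_def)
qed

subsection \<open>The risk of a random signal\<close>

locale signal = real_distribution p for p +
  assumes second_moment: "integrable p (\<lambda>x. x\<^sup>2)"
begin

sublocale pair_sigma_finite p \<N> ..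

definition energy :: real where "energy = (\<integral>x. x\<^sup>2 \<partial>p)"

text \<open>The risk after dividing signal, noise and threshold by \<sigma>: \<open>a\<close> stands
  for \<open>1 / \<sigma>\<close> and \<open>t\<close> for the normalized threshold.\<close>

definition scaled_risk :: "real \<Rightarrow> real \<Rightarrow> real" where
  "scaled_risk a t = (\<integral>x. shift_risk (a * x) t \<partial>p)"

lemma space_p [simp]: "space p = UNIV"
  using sets_eq_imp_space_eq[OF events_eq_borel] by simp

lemma measure_p_UNIV [simp]: "measure p UNIV = 1"
  using prob_space by simp

lemma
  fixes c d :: real
  shows integrable_pair_quadratic: "integrable (p \<Otimes>\<^sub>M \<N>) (\<lambda>(x, z). c * x\<^sup>2 + d * z\<^sup>2)"
    and integral_pair_quadratic: "(\<integral>(x, z). c * x\<^sup>2 + d * z\<^sup>2 \<partial>(p \<Otimes>\<^sub>M \<N>)) = c * energy + d"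
proof -
  have G: "measure \<N> UNIV = 1" using gauss.prob_space by simp
  have int: "integrable (p \<Otimes>\<^sub>M \<N>) (\<lambda>(x, z). c * x\<^sup>2 + d * z\<^sup>2)" for c d :: real
  proof -
    \<comment> \<open>Fubini's criterion concerns the norm, which is the function itself once the
      coefficients are nonnegative.\<close>
    have "integrable (p \<Otimes>\<^sub>M \<N>) (\<lambda>(x, z). \<bar>c\<bar> * x\<^sup>2 + \<bar>d\<bar> * z\<^sup>2)"
      by (rule Fubini_integrable) (use second_moment G in \<open>auto\<close>)
    then show ?thesis
      by (rule Bochner_Integration.integrable_bound)
         (auto simp: abs_mult intro!: order_trans[OF abs_triangle_ineq])
  qed
  then show "integrable (p \<Otimes>\<^sub>M \<N>) (\<lambda>(x, z). c * x\<^sup>2 + d * z\<^sup>2)" .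
  show "(\<integral>(x, z). c * x\<^sup>2 + d * z\<^sup>2 \<partial>(p \<Otimes>\<^sub>M \<N>)) = c * energy + d"
    using integral_fst'[OF int[of c d]] second_moment G by (simp add: energy_def)
qed

lemma integrable_soft_error_pair:
  assumes "0 \<le> l"
  shows "integrable (p \<Otimes>\<^sub>M \<N>) (\<lambda>(x, z). (soft_threshold (x + s * z) l - x)\<^sup>2)"
proof (rule Bochner_Integration.integrable_bound)
  show "integrable (p \<Otimes>\<^sub>M \<N>) (\<lambda>(x, z). 8 * x\<^sup>2 + (2 * s\<^sup>2) * z\<^sup>2)"
    by (rule integrable_pair_quadratic)
  show "AE y in p \<Otimes>\<^sub>M \<N>. norm (case y of (x, z) \<Rightarrow> (soft_threshold (x + s * z) l - x)\<^sup>2)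
      \<le> norm (case y of (x, z) \<Rightarrow> 8 * x\<^sup>2 + (2 * s\<^sup>2) * z\<^sup>2)"
    using soft_error_sq_le(1)[OF assms, of _ "s * _"]
    by (intro AE_I2) (auto simp: power_mult_distrib mult.assoc)
qed simp

lemma risk_alt: "risk p s l = (\<integral>(x, z). (soft_threshold (x + s * z) l - x)\<^sup>2 \<partial>(p \<Otimes>\<^sub>M \<N>))"
  by (simp add: risk_def)

lemma risk_nonneg: "0 \<le> risk p s l"
  unfolding risk_alt by (rule Bochner_Integration.integral_nonneg) auto

text \<open>Soft thresholding commutes with positive scaling, which pulls out the factor
  \<open>s\<^sup>2\<close>; Fubini then averages the unit-noise risk over the signal.\<close>

lemma risk_eq:
  assumes "0 < s" "0 \<le> l"
  shows "risk p s l = s\<^sup>2 * scaled_risk (1 / s) (l / s)"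
proof -
  have *: "(soft_threshold (x + s * z) l - x)\<^sup>2
      = s\<^sup>2 * (soft_threshold (1 / s * x + z) (l / s) - 1 / s * x)\<^sup>2" for x z
  proof -
    have "soft_threshold (x + s * z) l - x = s * (soft_threshold (1 / s * x + z) (l / s) - 1 / s * x)"
      using soft_threshold_scale[of s "1 / s * x + z" "l / s"] assms
      by (simp add: distrib_left right_diff_distrib)
    then show ?thesis by (simp add: power_mult_distrib)
  qed
  have "risk p s l = (\<integral>x. (\<integral>z. (soft_threshold (x + s * z) l - x)\<^sup>2 \<partial>\<N>) \<partial>p)"
    unfolding risk_alt using integral_fst'[OF integrable_soft_error_pair[OF assms(2)]] by simp
  also have "\<dots> = s\<^sup>2 * scaled_risk (1 / s) (l / s)"
    unfolding * scaled_risk_def shift_risk_def by simp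
  finally show ?thesis .
qed

lemma integrable_shift_risk [simp]:
  assumes "0 \<le> t" shows "integrable p (\<lambda>x. shift_risk (a * x) t)"
proof (rule integrable_const_bound)
  show "AE x in p. norm (shift_risk (a * x) t) \<le> 1 + t\<^sup>2"
    using shift_risk_le[OF assms] by simp
  show "(\<lambda>x. shift_risk (a * x) t) \<in> borel_measurable p"
    unfolding shift_risk_def by measurable
qed

lemma scaled_risk_mono:
  assumes "0 \<le> t" "0 \<le> a" "a \<le> b" shows "scaled_risk a t \<le> scaled_risk b t"
  unfolding scaled_risk_def using assms by (intro integral_mono shift_risk_mono) auto

lemma scaled_risk_zero_right [simp]: "scaled_risk a 0 = 1"
  by (simp add: scaled_risk_def)

lemma scaled_risk_strict_mono:
  assumes "0 < t" "0 \<le> a" "a < b" "prob {0} < 1" shows "scaled_risk a t < scaled_risk b t"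
  unfolding scaled_risk_def
proof (rule integral_less_AE)
  have "prob (- {0}) = 1 - prob {0}" using prob_compl[of "{0}"] by (simp add: Compl_eq_Diff_UNIV)
  then show "emeasure p (- {0}) \<noteq> 0"
    using assms by (simp add: emeasure_eq_measure)
  show "AE x in p. x \<in> - {0} \<longrightarrow> shift_risk (a * x) t \<noteq> shift_risk (b * x) t"
    using shift_risk_strict_mono[of t a b] assms by (intro AE_I2) (auto simp: less_imp_neq)
qed (use assms in \<open>auto intro!: shift_risk_mono\<close>)

text \<open>Off zero the risk is replaced by its supremum \<open>1 + t\<^sup>2\<close>. As this is
  at least the risk at zero, lowering the mass at zero to \<open>1 - e\<close> only increases the
  bound.\<close>

lemma scaled_risk_le:
  assumes "0 \<le> t" "1 - e \<le> prob {0}"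
  shows "scaled_risk a t \<le> (1 - e) * shift_risk 0 t + e * (1 + t\<^sup>2)"
proof -
  let ?d = "1 + t\<^sup>2 - shift_risk 0 t"
  have ind: "integrable p (\<lambda>x. ?d * indicator {0} x)"
    by (intro integrable_mult_right integrable_real_indicator) (auto simp: less_top[symmetric])
  then have int: "integrable p (\<lambda>x. (1 + t\<^sup>2) - ?d * indicator {0} x)"
    by (intro Bochner_Integration.integrable_diff integrable_const)
  have "scaled_risk a t \<le> (\<integral>x. (1 + t\<^sup>2) - ?d * indicator {0} x \<partial>p)"
    unfolding scaled_risk_def
    using shift_risk_le[OF assms(1)] assms(1)
    by (intro integral_mono[OF _ int]) (auto simp: indicator_def)
  also have "\<dots> = (1 + t\<^sup>2) - ?d * prob {0}"
    by (subst Bochner_Integration.integral_diff[OF integrable_const ind]) simp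
  also have "\<dots> \<le> (1 + t\<^sup>2) - ?d * (1 - e)"
    using mult_left_mono[OF assms(2), of ?d] shift_risk_le[OF assms(1), of 0] by simp
  finally show ?thesis by (simp add: algebra_simps)
qed

lemma risk_tendsto_top: "((\<lambda>l. risk p s l) \<longlongrightarrow> energy) at_top"
proof -
  have "((\<lambda>l. risk p s l) \<longlongrightarrow> (\<integral>(x, z). x\<^sup>2 \<partial>(p \<Otimes>\<^sub>M \<N>))) at_top"
    unfolding risk_alt
  proof (rule integral_dominated_convergence_at_top
      [where w = "\<lambda>(x, z). 8 * x\<^sup>2 + (2 * s\<^sup>2) * z\<^sup>2"])
    show "integrable (p \<Otimes>\<^sub>M \<N>) (\<lambda>(x, z). 8 * x\<^sup>2 + (2 * s\<^sup>2) * z\<^sup>2)"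
      by (rule integrable_pair_quadratic)
    have "((\<lambda>l. (soft_threshold (x + s * z) l - x)\<^sup>2) \<longlongrightarrow> x\<^sup>2) at_top" for x z
    proof (rule tendsto_eventually)
      show "\<forall>\<^sub>F l in at_top. (soft_threshold (x + s * z) l - x)\<^sup>2 = x\<^sup>2"
        using eventually_gt_at_top[of "\<bar>x + s * z\<bar>"]
        by eventually_elim (simp add: soft_threshold_def)
    qed
    then show "AE y in p \<Otimes>\<^sub>M \<N>. ((\<lambda>l. case y of (x, z) \<Rightarrow> (soft_threshold (x + s * z) l - x)\<^sup>2)
        \<longlongrightarrow> (case y of (x, z) \<Rightarrow> x\<^sup>2)) at_top"
      by (intro AE_I2) auto
    show "\<forall>\<^sub>F l in at_top. AE y in p \<Otimes>\<^sub>M \<N>.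
        norm (case y of (x, z) \<Rightarrow> (soft_threshold (x + s * z) l - x)\<^sup>2)
        \<le> (case y of (x, z) \<Rightarrow> 8 * x\<^sup>2 + (2 * s\<^sup>2) * z\<^sup>2)"
      using eventually_ge_at_top[of 0]
    proof eventually_elim
      case (elim l)
      show ?case
        using soft_error_sq_le(1)[OF elim, of _ "s * _"]
        by (intro AE_I2) (auto simp: power_mult_distrib mult.assoc)
    qed
  qed auto
  then show ?thesis using integral_pair_quadratic[of 1 0] by simp
qed

text \<open>Thresholding is 1-Lipschitz, so changing the noise level moves the error by at most
  \<open>d * \<bar>z\<bar>\<close>. The constants do not depend on \<open>l\<close>, hence the
  estimate passes to the minimum over thresholds.\<close>

lemma risk_perturb:
  assumes "0 \<le> l" and d: "d = \<bar>s - s'\<bar>"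
  shows "risk p s l \<le> (1 + d) * risk p s' l + (d\<^sup>2 + d)"
proof -
  have pt: "(soft_threshold (x + s * z) l - x)\<^sup>2
      \<le> (1 + d) * (soft_threshold (x + s' * z) l - x)\<^sup>2 + (d\<^sup>2 + d) * z\<^sup>2" for x z
  proof (cases "d = 0")
    case True
    then show ?thesis using d by simp
  next
    case False
    then have "d > 0" using d by simp
    define A where "A = soft_threshold (x + s' * z) l - x"
    define B where "B = soft_threshold (x + s * z) l - soft_threshold (x + s' * z) l"
    have "\<bar>soft_threshold u l - soft_threshold v l\<bar> \<le> \<bar>u - v\<bar>" for u v
      using assms by (auto simp: soft_threshold_eq max_def)
    then have "\<bar>B\<bar> \<le> \<bar>(x + s * z) - (x + s' * z)\<bar>"
      unfolding B_def .
    also have "\<dots> = d * \<bar>z\<bar>"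
      using d by (simp add: abs_mult[symmetric] algebra_simps)
    finally have "B\<^sup>2 \<le> (d * \<bar>z\<bar>)\<^sup>2"
      by (metis abs_ge_zero power2_abs power_mono)
    then have B: "(1 + 1 / d) * B\<^sup>2 \<le> (1 + 1 / d) * (d\<^sup>2 * z\<^sup>2)"
      using \<open>d > 0\<close> by (intro mult_left_mono) (auto simp: power_mult_distrib)
    \<comment> \<open>Young's inequality with weight \<open>d\<close>: since
      \<open>\<bar>B\<bar>\<close> is at most \<open>d * \<bar>z\<bar>\<close>, the second term is
      of order \<open>d\<close> in spite of the factor \<open>1 / d\<close>.\<close>
    have "(A + B)\<^sup>2 \<le> (1 + d) * A\<^sup>2 + (1 + 1 / d) * B\<^sup>2"
    proof -
      have "(1 + d) * A\<^sup>2 + (1 + 1 / d) * B\<^sup>2 - (A + B)\<^sup>2 = (d * A - B)\<^sup>2 / d"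
        using \<open>d > 0\<close> by (simp add: power2_eq_square field_simps)
      then show ?thesis using \<open>d > 0\<close> by (smt (verit) divide_nonneg_pos zero_le_power2)
    qed
    also have "\<dots> \<le> (1 + d) * A\<^sup>2 + (d\<^sup>2 + d) * z\<^sup>2"
    proof -
      have "(1 + 1 / d) * (d\<^sup>2 * z\<^sup>2) = (d\<^sup>2 + d) * z\<^sup>2"
        using \<open>d > 0\<close> by (simp add: power2_eq_square field_simps)
      then show ?thesis using B by linarith
    qed
    finally show ?thesis by (simp add: A_def B_def)
  qed
  have i1: "integrable (p \<Otimes>\<^sub>M \<N>) (\<lambda>y. (1 + d) * (case y of (x, z) \<Rightarrow> (soft_threshold (x + s' * z) l - x)\<^sup>2))"
    using integrable_soft_error_pair[OF assms(1)] by simp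
  have i2: "integrable (p \<Otimes>\<^sub>M \<N>) (\<lambda>(x, z). 0 * x\<^sup>2 + (d\<^sup>2 + d) * z\<^sup>2)"
    by (rule integrable_pair_quadratic)
  have "risk p s l \<le> (\<integral>y. (1 + d) * (case y of (x, z) \<Rightarrow> (soft_threshold (x + s' * z) l - x)\<^sup>2)
      + (case y of (x, z) \<Rightarrow> 0 * x\<^sup>2 + (d\<^sup>2 + d) * z\<^sup>2) \<partial>(p \<Otimes>\<^sub>M \<N>))"
    unfolding risk_alt
  proof (rule integral_mono[OF integrable_soft_error_pair[OF assms(1)]
        Bochner_Integration.integrable_add[OF i1 i2]])
    show "(case y of (x, z) \<Rightarrow> (soft_threshold (x + s * z) l - x)\<^sup>2)
        \<le> (1 + d) * (case y of (x, z) \<Rightarrow> (soft_threshold (x + s' * z) l - x)\<^sup>2)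
        + (case y of (x, z) \<Rightarrow> 0 * x\<^sup>2 + (d\<^sup>2 + d) * z\<^sup>2)" for y
      using pt by (cases y) auto
  qed
  also have "\<dots> = (1 + d) * risk p s' l + (d\<^sup>2 + d)"
    unfolding risk_alt Bochner_Integration.integral_add[OF i1 i2]
    by (simp add: integral_pair_quadratic[of 0, simplified])
  finally show ?thesis .
qed

end

subsection \<open>The minimal risk\<close>

locale optimal_signal = signal +
  fixes lam
  assumes policy: "optimal_policy p lam"
begin

text \<open>This value is the same for every selection of minimizers, so it can be continuous
  although \<open>lam\<close> is arbitrary.\<close>

definition min_risk :: "real \<Rightarrow> real" where "min_risk s = risk p s (lam s)"

lemma lam_nonneg: "0 \<le> s \<Longrightarrow> 0 \<le> lam s"
  and min_risk_le: "0 \<le> s \<Longrightarrow> 0 \<le> l \<Longrightarrow> min_risk s \<le> risk p s l"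
  using policy unfolding optimal_policy_def is_arg_min_def min_risk_def by (auto simp: not_less)

lemma min_risk_nonneg: "0 \<le> min_risk s"
  unfolding min_risk_def by (rule risk_nonneg)

lemma min_risk_zero: "min_risk 0 = 0"
  using min_risk_le[of 0 0] min_risk_nonneg[of 0] by (simp add: risk_def case_prod_unfold)

text \<open>As the threshold grows, every estimate becomes zero and the error becomes the signal
  itself.\<close>

lemma min_risk_le_energy:
  assumes "0 \<le> s" shows "min_risk s \<le> energy"
proof (rule tendsto_lowerbound[OF risk_tendsto_top])
  show "\<forall>\<^sub>F l in at_top. min_risk s \<le> risk p s l"
    using eventually_ge_at_top[of 0] by eventually_elim (use assms min_risk_le in auto)
qed simp

lemma energy_nonneg: "0 \<le> energy"
  unfolding energy_def by (rule Bochner_Integration.integral_nonneg) auto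

text \<open>The optimal threshold for \<open>s'\<close> is tried at \<open>s\<close>. Exchanging the
  roles of \<open>s\<close> and \<open>s'\<close> then gives continuity.\<close>

lemma min_risk_perturb:
  assumes "0 \<le> s" "0 \<le> s'"
  shows "min_risk s \<le> min_risk s' + \<bar>s - s'\<bar> * (energy + \<bar>s - s'\<bar> + 1)"
proof -
  let ?d = "\<bar>s - s'\<bar>"
  have "min_risk s \<le> (1 + ?d) * min_risk s' + (?d\<^sup>2 + ?d)"
    using min_risk_le[OF assms(1) lam_nonneg[OF assms(2)]]
      risk_perturb[OF lam_nonneg[OF assms(2)] refl, of s s'] by (simp add: min_risk_def)
  moreover have "?d * min_risk s' \<le> ?d * energy"
    using min_risk_le_energy[OF assms(2)] by (intro mult_left_mono) auto
  ultimately show ?thesis by (simp add: power2_eq_square algebra_simps)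
qed

lemma continuous_on_min_risk: "continuous_on {0..} min_risk"
  unfolding continuous_on_def
proof
  fix s :: real assume s: "s \<in> {0..}"
  let ?D = "\<lambda>u. \<bar>u - s\<bar> * (energy + \<bar>u - s\<bar> + 1)"
  have D: "(?D \<longlongrightarrow> 0) (at s within {0..})"
    by (auto intro!: tendsto_eq_intros)
  have "\<forall>\<^sub>F u in at s within {0..}. norm (min_risk u - min_risk s) \<le> ?D u"
    unfolding eventually_at_filter
  proof (intro always_eventually allI impI)
    fix u :: real assume "u \<in> {0..}"
    then show "norm (min_risk u - min_risk s) \<le> ?D u"
      using min_risk_perturb[of u s] min_risk_perturb[of s u] s
      by (simp add: abs_minus_commute)
  qed
  then have "((\<lambda>u. min_risk u - min_risk s) \<longlongrightarrow> 0) (at s within {0..})"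
    using D by (rule Lim_null_comparison)
  then show "(min_risk \<longlongrightarrow> min_risk s) (at s within {0..})"
    by (rule LIM_zero_cancel)
qed

text \<open>Keep the normalized threshold \<open>lam s / s\<close> when passing from \<open>s\<close> to a larger \<open>t\<close>.\<close>

lemma
  assumes "0 < s" "s < t"
  shows min_risk_ratio_antimono: "min_risk t / t\<^sup>2 \<le> min_risk s / s\<^sup>2"
    and min_risk_ratio_strict: "prob {0} < 1 \<Longrightarrow> min_risk s / s\<^sup>2 < 1 \<Longrightarrow> min_risk t / t\<^sup>2 < min_risk s / s\<^sup>2"
proof -
  define \<tau> where "\<tau> = lam s / s"
  have "0 \<le> \<tau>" using assms lam_nonneg[of s] by (simp add: \<tau>_def)
  have s: "min_risk s / s\<^sup>2 = scaled_risk (1 / s) \<tau>"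
    using assms risk_eq[of s "lam s"] lam_nonneg[of s] by (simp add: min_risk_def \<tau>_def)
  have t: "min_risk t / t\<^sup>2 \<le> scaled_risk (1 / t) \<tau>"
    using min_risk_le[of t "t * \<tau>"] risk_eq[of t "t * \<tau>"] assms \<open>0 \<le> \<tau>\<close>
    by (simp add: field_simps)
  have inv: "1 / t < 1 / s" "0 \<le> 1 / t" using assms by (simp_all add: frac_less2)
  show "min_risk t / t\<^sup>2 \<le> min_risk s / s\<^sup>2"
    using scaled_risk_mono[OF \<open>0 \<le> \<tau>\<close> inv(2), of "1 / s"] inv s t by simp
  assume *: "prob {0} < 1" "min_risk s / s\<^sup>2 < 1"
  \<comment> \<open>A zero threshold would make the ratio exactly 1.\<close>
  then have "\<tau> \<noteq> 0" using s by auto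
  then show "min_risk t / t\<^sup>2 < min_risk s / s\<^sup>2"
    using scaled_risk_strict_mono[of \<tau> "1 / t" "1 / s"] inv s t * \<open>0 \<le> \<tau>\<close> by simp
qed

lemma min_risk_ratio_less:
  assumes "0 < c" shows "\<exists>s>0. min_risk s / s\<^sup>2 < c"
proof (intro exI conjI)
  \<comment> \<open>Here \<open>c * ?s\<^sup>2\<close> equals \<open>energy + c\<close>, which
    exceeds the bound on the minimal risk; the summand 1 also keeps \<open>?s\<close> positive when
    the energy is 0.\<close>
  let ?s = "sqrt (energy / c + 1)"
  have pos: "0 < energy / c + 1" using assms energy_nonneg by (simp add: add_nonneg_pos)
  then show "0 < ?s" by simp
  have "min_risk ?s \<le> energy" using pos by (intro min_risk_le_energy) simp
  also have "energy < c * (energy / c + 1)" using assms by (simp add: field_simps)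
  finally show "min_risk ?s / ?s\<^sup>2 < c" using pos by (simp add: divide_less_eq)
qed

end

subsection \<open>Stable fixed points\<close>

text \<open>\<open>h s\<close> is the ratio of \<open>\<Psi> (s\<^sup>2)\<close> to
  \<open>s\<^sup>2\<close>. Strict decrease is demanded only from level 1 downwards, where it can be
  proved for the minimal risk. The last assumption guarantees that if \<open>h\<close> stays below 1
  everywhere, then 0 is a fixed point.\<close>

locale unique_crossing =
  fixes \<Psi> h :: "real \<Rightarrow> real"
  assumes cont: "continuous_on {0<..} h"
    and strict: "\<And>s t. 0 < s \<Longrightarrow> s < t \<Longrightarrow> h s \<le> 1 \<Longrightarrow> h t < h s"
    and low: "\<exists>s>0. h s < 1"
    and \<Psi>_sq: "\<And>s. 0 < s \<Longrightarrow> \<Psi> (s\<^sup>2) = s\<^sup>2 * h s"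
    and \<Psi>_zero: "\<Psi> 0 \<noteq> 0 \<Longrightarrow> \<exists>s>0. 1 \<le> h s"
begin

lemma \<Psi>_less_iff: "0 < s \<Longrightarrow> \<Psi> (s\<^sup>2) < s\<^sup>2 \<longleftrightarrow> h s < 1"
  and \<Psi>_greater_iff: "0 < s \<Longrightarrow> \<Psi> (s\<^sup>2) > s\<^sup>2 \<longleftrightarrow> h s > 1"
  and \<Psi>_eq_iff: "0 < s \<Longrightarrow> \<Psi> (s\<^sup>2) = s\<^sup>2 \<longleftrightarrow> h s = 1"
  by (simp_all add: \<Psi>_sq)

text \<open>The local condition becomes global because \<open>h\<close> cannot rise again once it is
  below 1.\<close>

lemma stable_zero_iff: "stable_fixed_point \<Psi> 0 \<longleftrightarrow> \<Psi> 0 = 0 \<and> (\<forall>s>0. h s < 1)"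
proof
  assume "stable_fixed_point \<Psi> 0"
  then obtain c where c: "\<Psi> 0 = 0" "c > 0" "\<And>s. 0 < s \<Longrightarrow> s < c \<Longrightarrow> h s < 1"
    unfolding stable_fixed_point_def using \<Psi>_less_iff by auto
  have "h s < 1" if "s > 0" for s
  proof (cases "s < c")
    case True
    then show ?thesis using c that by blast
  next
    case False
    have "h (c / 2) < 1" using c by simp
    moreover have "h s < h (c / 2)"
      using strict[of "c / 2" s] False c calculation by linarith
    ultimately show ?thesis by simp
  qed
  then show "\<Psi> 0 = 0 \<and> (\<forall>s>0. h s < 1)" using c by blast
next
  assume "\<Psi> 0 = 0 \<and> (\<forall>s>0. h s < 1)"
  then show "stable_fixed_point \<Psi> 0"
    unfolding stable_fixed_point_def using \<Psi>_less_iff by (auto intro!: exI[of _ 1])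
qed

text \<open>Were \<open>h u\<close> at most 1, then \<open>h s\<close> would be strictly below
  1.\<close>

lemma greater_before_crossing:
  assumes "h s = 1" "0 < u" "u < s" shows "1 < h u"
  using strict[of u s] assms by (cases "h u \<le> 1") auto

lemma stable_pos_iff:
  assumes "s \<noteq> 0" shows "stable_fixed_point \<Psi> s \<longleftrightarrow> 0 < s \<and> h s = 1"
proof
  assume "stable_fixed_point \<Psi> s"
  then show "0 < s \<and> h s = 1"
    using assms \<Psi>_eq_iff unfolding stable_fixed_point_def by auto
next
  assume s: "0 < s \<and> h s = 1"
  \<comment> \<open>The lower end 0 keeps \<sigma> positive; the upper end is an arbitrary point
    beyond \<open>s\<close>.\<close>
  have "\<forall>\<sigma>\<in>{0<..<s + 1}. 0 \<le> \<sigma> \<longrightarrow> (s < \<sigma> \<longrightarrow> \<Psi> (\<sigma>\<^sup>2) < \<sigma>\<^sup>2) \<and> (\<sigma> < s \<longrightarrow> \<sigma>\<^sup>2 < \<Psi> (\<sigma>\<^sup>2))"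
    using s strict[of s] greater_before_crossing[of s] by (auto simp: \<Psi>_less_iff \<Psi>_greater_iff)
  moreover have "s \<in> {0<..<s + 1}" using s by simp
  ultimately have "\<exists>a b. s \<in> {a<..<b} \<and> (\<forall>\<sigma>\<in>{a<..<b}. 0 \<le> \<sigma> \<longrightarrow>
      (s < \<sigma> \<longrightarrow> \<Psi> (\<sigma>\<^sup>2) < \<sigma>\<^sup>2) \<and> (\<sigma> < s \<longrightarrow> \<sigma>\<^sup>2 < \<Psi> (\<sigma>\<^sup>2)))"
    by blast
  then show "stable_fixed_point \<Psi> s"
    using assms s \<Psi>_eq_iff unfolding stable_fixed_point_def by simp
qed

text \<open>If \<open>h\<close> stays below 1, zero is stable and there is no crossing. Otherwise
  the intermediate value theorem gives a crossing, zero is unstable, and strict decrease excludes a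
  second crossing.\<close>

lemma ex1_stable: "\<exists>!s. stable_fixed_point \<Psi> s"
proof (cases "\<exists>s>0. 1 \<le> h s")
  case False
  then have "stable_fixed_point \<Psi> 0"
    using stable_zero_iff \<Psi>_zero by force
  moreover have "s = 0" if "stable_fixed_point \<Psi> s" for s
    using that False stable_pos_iff[of s] by force
  ultimately show ?thesis by blast
next
  case True
  then obtain a where a: "0 < a" "1 \<le> h a" by blast
  obtain b where b: "0 < b" "h b < 1" using low by blast
  have "a < b"
    using strict[of b a] a b by (cases a b rule: linorder_cases) auto
  moreover have "continuous_on {a..b} h"
    using a by (intro continuous_on_subset[OF cont]) auto
  ultimately obtain s where s: "a \<le> s" "h s = 1"
    using IVT2'[of h b 1 a] a b by auto
  have "stable_fixed_point \<Psi> s"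
    using s a by (subst stable_pos_iff) auto
  moreover have "t = s" if t: "stable_fixed_point \<Psi> t" for t
  proof (cases "t = 0")
    case True
    then have "h a < 1" using t a stable_zero_iff by auto
    then show ?thesis using a by simp
  next
    case False
    then have "0 < t" "h t = 1" using t stable_pos_iff by auto
    then show ?thesis
      using greater_before_crossing[of t s] greater_before_crossing[of s t] s a
      by (cases s t rule: linorder_cases) auto
  qed
  ultimately show ?thesis by blast
qed

end

section \<open>State evolution as a map with a single crossing\<close>

context optimal_signal
begin

lemma state_evolution_eq:
  "0 \<le> s \<Longrightarrow> state_evolution p w d lam (s\<^sup>2) = w\<^sup>2 + min_risk s / d"
  by (simp add: state_evolution_def min_risk_def)

text \<open>For a signal that is almost surely 0 the energy is 0, so the minimal risk would have to
  vanish, yet every real threshold has positive risk at noise level 1.\<close>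

lemma prob_zero_less_1: "prob {0} < 1"
proof (rule ccontr)
  assume "\<not> prob {0} < 1"
  then have AE: "AE x in p. x = 0"
    using prob_eq_1[of "{0}"] prob_le_1[of "{0}"] by auto
  have "min_risk 1 = scaled_risk 1 (lam 1)"
    using risk_eq[of 1 "lam 1"] lam_nonneg[of 1] by (simp add: min_risk_def)
  also have "\<dots> = (\<integral>x. shift_risk 0 (lam 1) \<partial>p)"
    unfolding scaled_risk_def
  proof (rule integral_cong_AE)
    show "(\<lambda>x. shift_risk (1 * x) (lam 1)) \<in> borel_measurable p"
      using integrable_shift_risk[OF lam_nonneg, of 1 1] by auto
  qed (use AE in auto)
  also have "\<dots> > 0" by (simp add: shift_risk_zero_pos lam_nonneg)
  finally have "0 < min_risk 1" .
  moreover have "energy = (\<integral>x. 0 \<partial>p)"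
    unfolding energy_def by (rule integral_cong_AE) (use AE in auto)
  ultimately show False using min_risk_le_energy[of 1] by simp
qed

lemma unique_crossing_state_evolution:
  assumes "0 < d" "d < 1"
  shows "unique_crossing (state_evolution p w d lam) (\<lambda>s. w\<^sup>2 / s\<^sup>2 + min_risk s / s\<^sup>2 / d)"
proof
  let ?h = "\<lambda>s. w\<^sup>2 / s\<^sup>2 + min_risk s / s\<^sup>2 / d"
  have mono: "min_risk t / t\<^sup>2 / d \<le> min_risk s / s\<^sup>2 / d" if "0 < s" "s < t" for s t
    using min_risk_ratio_antimono[OF that] assms by (intro divide_right_mono) auto
  show "continuous_on {0<..} ?h"
    using assms by (auto intro!: continuous_intros continuous_on_subset[OF continuous_on_min_risk])
  show "?h t < ?h s" if "0 < s" "s < t" "?h s \<le> 1" for s t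
  proof (cases "w = 0")
    case True
    \<comment> \<open>Without noise, \<open>?h s \<le> 1\<close> puts the ratio at most at
      \<open>d\<close>; here \<open>d < 1\<close> is what makes the strict decrease
      available.\<close>
    then have "min_risk s / s\<^sup>2 \<le> d" using that assms by (simp add: divide_le_eq mult.commute)
    then have "min_risk t / t\<^sup>2 < min_risk s / s\<^sup>2"
      using min_risk_ratio_strict[OF that(1,2) prob_zero_less_1] assms by simp
    then have "min_risk t / t\<^sup>2 / d < min_risk s / s\<^sup>2 / d"
      using assms(1) by (rule divide_strict_right_mono)
    then show ?thesis using True by simp
  next
    case False
    then have "w\<^sup>2 / t\<^sup>2 < w\<^sup>2 / s\<^sup>2"
      using that by (intro divide_strict_left_mono) (auto simp: power_strict_mono)
    then show ?thesis using mono[OF that(1,2)] by simp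
  qed
  show "\<exists>s>0. ?h s < 1"
  proof -
    obtain s where s: "0 < s" "min_risk s / s\<^sup>2 < d / 2"
      using min_risk_ratio_less[of "d / 2"] assms by auto
    \<comment> \<open>Beyond \<open>s\<close> the risk term stays below \<open>1 / 2\<close>, and
      beyond \<open>2 * \<bar>w\<bar>\<close> so does the noise term.\<close>
    define t where "t = max (s + 1) (2 * \<bar>w\<bar> + 1)"
    have t: "s < t" "2 * \<bar>w\<bar> < t" "0 < t" using s by (auto simp: t_def)
    have "(2 * \<bar>w\<bar>)\<^sup>2 < t\<^sup>2" using t by (intro power_strict_mono) auto
    then have "4 * w\<^sup>2 < t\<^sup>2" by (simp add: power_mult_distrib)
    then have "2 * w\<^sup>2 < t\<^sup>2" using zero_le_power2[of w] by linarith
    then have "w\<^sup>2 / t\<^sup>2 < 1 / 2" using t by (simp add: divide_less_eq)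
    moreover have "min_risk t / t\<^sup>2 / d < 1 / 2"
    proof -
      have "min_risk s / s\<^sup>2 / d < 1 / 2" using s assms by (simp add: divide_less_eq mult.commute)
      then show ?thesis using mono[OF s(1) t(1)] by linarith
    qed
    ultimately have "?h t < 1" by linarith
    then show ?thesis using t(3) by blast
  qed
  show "state_evolution p w d lam (s\<^sup>2) = s\<^sup>2 * ?h s" if "0 < s" for s
    using that by (simp add: state_evolution_eq distrib_left)
  assume "state_evolution p w d lam 0 \<noteq> 0"
  then have "w \<noteq> 0" using state_evolution_eq[of 0] min_risk_zero by auto
  \<comment> \<open>At \<open>s = \<bar>w\<bar>\<close> the noise term alone equals 1.\<close>
  then show "\<exists>s>0. 1 \<le> ?h s"
    using assms min_risk_nonneg[of "\<bar>w\<bar>"] by (intro exI[of _ "\<bar>w\<bar>"]) auto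
qed

end

subsection \<open>Gaussian tails\<close>

text \<open>The upper partial moments of the Gaussian; those of order 1 and 2 express the
  risk.\<close>

definition gauss_tail :: "nat \<Rightarrow> real \<Rightarrow> real" where
  "gauss_tail k a = (\<integral>z. (max (z - a) 0) ^ k \<partial>\<N>)"

lemma integrable_gauss_tail:
  assumes "k = 1 \<or> k = 2" shows "integrable \<N> (\<lambda>z. (max (z - a) 0) ^ k)"
proof (rule Bochner_Integration.integrable_bound)
  show "integrable \<N> (\<lambda>z. 2 * z\<^sup>2 + (2 * a\<^sup>2 + 1))" by simp
  show "AE z in \<N>. norm ((max (z - a) 0) ^ k) \<le> norm (2 * z\<^sup>2 + (2 * a\<^sup>2 + 1))"
  proof (rule AE_I2)
    fix z :: real
    have "(z - a)\<^sup>2 \<le> 2 * z\<^sup>2 + 2 * a\<^sup>2" "z - a \<le> (z - a)\<^sup>2 + 1"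
      using zero_le_power2[of "z + a"] zero_le_power2[of "z - a - 1 / 2"]
      by (simp_all add: power2_eq_square algebra_simps)
    then show "norm ((max (z - a) 0) ^ k) \<le> norm (2 * z\<^sup>2 + (2 * a\<^sup>2 + 1))"
      using assms by (auto simp: max_def)
  qed
qed simp

lemma gauss_tail_nonneg [simp]: "0 \<le> gauss_tail k a"
  unfolding gauss_tail_def by (rule Bochner_Integration.integral_nonneg) simp

text \<open>Translating by \<open>s\<close> multiplies the density by
  \<open>exp (- (s * z) - s\<^sup>2 / 2)\<close>, which is at most \<open>exp (- (s * a))\<close>
  where the integrand is nonzero.\<close>

lemma gauss_tail_shift_le:
  assumes k: "k = 1 \<or> k = 2" and s: "0 \<le> s"
  shows "gauss_tail k (a + s) \<le> exp (- (s * a)) * gauss_tail k a"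
proof -
  \<comment> \<open>A vanishing positive part contributes 0 only for a positive exponent, as
    \<open>0 ^ 0 = 1\<close>.\<close>
  have pos: "0 < k" using k by auto
  have "gauss_tail k (a + s) = (\<integral>z. std_normal_density z * (max (z - (a + s)) 0) ^ k \<partial>lborel)"
    unfolding gauss_tail_def by (subst integral_density) auto
  also have "\<dots> = (\<integral>z. std_normal_density (s + z) * (max (z - a) 0) ^ k \<partial>lborel)"
    by (subst lborel_integral_real_affine[of 1 _ s]) (auto simp: algebra_simps)
  also have "\<dots> = (\<integral>z. exp (- (s * z) - s\<^sup>2 / 2) * (max (z - a) 0) ^ k \<partial>\<N>)"
  proof (subst integral_density)
    have "std_normal_density (s + z) = std_normal_density z * exp (- (s * z) - s\<^sup>2 / 2)" for z
      by (simp add: std_normal_density_def exp_add[symmetric] power2_sum field_simps)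
    then show "(\<integral>z. std_normal_density (s + z) * (max (z - a) 0) ^ k \<partial>lborel)
        = (\<integral>z. std_normal_density z *\<^sub>R (exp (- (s * z) - s\<^sup>2 / 2) * (max (z - a) 0) ^ k) \<partial>lborel)"
      by (simp add: mult.assoc)
  qed auto
  also have "\<dots> \<le> (\<integral>z. exp (- (s * a)) * (max (z - a) 0) ^ k \<partial>\<N>)"
  proof (rule integral_mono')
    show "integrable \<N> (\<lambda>z. exp (- (s * a)) * (max (z - a) 0) ^ k)"
      using integrable_gauss_tail[OF k] by simp
    show "exp (- (s * z) - s\<^sup>2 / 2) * (max (z - a) 0) ^ k \<le> exp (- (s * a)) * (max (z - a) 0) ^ k" for z
    proof (cases "a \<le> z")
      case True
      then have "s * a \<le> s * z" using s by (rule mult_left_mono)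
      then have "- (s * z) - s\<^sup>2 / 2 \<le> - (s * a)" using zero_le_power2[of s] by linarith
      then show ?thesis by (intro mult_right_mono) auto
    next
      case False
      then show ?thesis using pos by (simp add: max_def power_0_left)
    qed
  qed simp
  also have "\<dots> = exp (- (s * a)) * gauss_tail k a"
    by (simp add: gauss_tail_def)
  finally show ?thesis .
qed

text \<open>Comparing the tail at \<open>a\<close> with the exponentially smaller one at \<open>a + s\<close> replaces
  integration by parts.\<close>

lemma gauss_tail_2_le_1:
  assumes "0 \<le> s" "exp (- (s * a)) \<le> 1 / 2"
  shows "gauss_tail 2 a \<le> 4 * s * gauss_tail 1 a"
proof -
  \<comment> \<open>For \<open>y = z - a\<close> above \<open>s\<close>, the square of
    \<open>y\<close> is \<open>(y - s)\<^sup>2 + 2 * s * y - s\<^sup>2\<close>.\<close>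
  have "(max (z - a) 0)\<^sup>2 \<le> (max (z - (a + s)) 0)\<^sup>2 + 2 * s * (max (z - a) 0) ^ 1" for z
  proof (cases "z - a \<le> s")
    case True
    have "(max (z - a) 0)\<^sup>2 \<le> 2 * s * max (z - a) 0"
      unfolding power2_eq_square using True assms(1) by (intro mult_right_mono) auto
    then show ?thesis by (simp add: add_increasing)
  next
    case False
    then have "max (z - a) 0 = z - a" "max (z - (a + s)) 0 = z - a - s" using assms(1) by auto
    then show ?thesis by (simp add: power2_eq_square algebra_simps)
  qed
  then have "gauss_tail 2 a \<le> (\<integral>z. (max (z - (a + s)) 0)\<^sup>2 + 2 * s * (max (z - a) 0) ^ 1 \<partial>\<N>)"
    unfolding gauss_tail_def
    using integrable_gauss_tail[of 1 a] integrable_gauss_tail[of 2]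
    by (intro integral_mono) auto
  also have "\<dots> = gauss_tail 2 (a + s) + 2 * s * gauss_tail 1 a"
    unfolding gauss_tail_def
    using integrable_gauss_tail[of 1 a] integrable_gauss_tail[of 2 "a + s"] by simp
  \<comment> \<open>Half of the left-hand side is absorbed, which turns the factor
    \<open>2 * s\<close> into \<open>4 * s\<close>.\<close>
  also have "gauss_tail 2 (a + s) \<le> 1 / 2 * gauss_tail 2 a"
    using gauss_tail_shift_le[of 2 s a] mult_right_mono[OF assms(2), of "gauss_tail 2 a"] assms(1)
    by simp
  finally show ?thesis by simp
qed

text \<open>The upper and lower exceedances of the threshold have disjoint supports, so their cross
  term vanishes on squaring; reflecting the lower one gives an upper tail.\<close>

lemma shift_risk_eq_gauss_tail:
  assumes "0 \<le> t"
  shows "shift_risk m t = m\<^sup>2 + gauss_tail 2 (t - m) + gauss_tail 2 (t + m)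
    - 2 * m * gauss_tail 1 (t - m) + 2 * m * gauss_tail 1 (t + m)"
proof -
  let ?P = "\<lambda>z::real. max (z - (t - m)) 0" and ?Q = "\<lambda>z::real. max (z - (t + m)) 0"
  have pt: "(soft_threshold (m + z) t - m)\<^sup>2
      = m\<^sup>2 + (?P z)\<^sup>2 + (?Q (- z))\<^sup>2 - 2 * m * ?P z + 2 * m * ?Q (- z)" for z
    using assms by (auto simp: soft_threshold_eq max_def power2_eq_square algebra_simps)
  have flip: "integrable \<N> (\<lambda>z. f (- z))" if "integrable \<N> f" for f :: "real \<Rightarrow> real"
  proof -
    have [measurable]: "f \<in> borel_measurable borel"
      using borel_measurable_integrable[OF that] by simp
    have "integrable lborel (\<lambda>z. std_normal_density z *\<^sub>R f z)"
      using that by (subst (asm) integrable_density) auto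
    then have "integrable lborel (\<lambda>z. std_normal_density (0 + - 1 * z) *\<^sub>R f (0 + - 1 * z))"
      by (subst lborel_integrable_real_affine_iff) auto
    then show ?thesis
      using that by (subst integrable_density) (auto simp: normal_density_def)
  qed
  have P: "integrable \<N> ?P" "integrable \<N> (\<lambda>z. (?P z)\<^sup>2)"
    and Q: "integrable \<N> ?Q" "integrable \<N> (\<lambda>z. (?Q z)\<^sup>2)"
    using integrable_gauss_tail[of 1] integrable_gauss_tail[of 2] by simp_all
  have Q': "integrable \<N> (\<lambda>z. ?Q (- z))" "integrable \<N> (\<lambda>z. (?Q (- z))\<^sup>2)"
    using flip[OF Q(1)] flip[OF Q(2)] .
  have "shift_risk m t = m\<^sup>2 + (\<integral>z. (?P z)\<^sup>2 \<partial>\<N>) + (\<integral>z. (?Q (- z))\<^sup>2 \<partial>\<N>)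
      - 2 * m * (\<integral>z. ?P z \<partial>\<N>) + 2 * m * (\<integral>z. ?Q (- z) \<partial>\<N>)"
    unfolding shift_risk_def pt using P Q' gauss.prob_space by (simp add: measure_def)
  also have "(\<integral>z. (?Q (- z))\<^sup>2 \<partial>\<N>) = gauss_tail 2 (t + m)"
    using gauss_integral_minus[of "\<lambda>z. (?Q z)\<^sup>2"] by (simp add: gauss_tail_def)
  also have "(\<integral>z. ?Q (- z) \<partial>\<N>) = gauss_tail 1 (t + m)"
    using gauss_integral_minus[of ?Q] by (simp add: gauss_tail_def)
  finally show ?thesis by (simp add: gauss_tail_def)
qed

subsection \<open>Two-point signals\<close>

text \<open>The expression inside \<open>M1\<close> at \<mu> = \<open>m\<close>, and at the same
  time the scaled risk of the two-point signal with its nonzero value at \<open>m\<close>.\<close>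

definition mix_risk :: "real \<Rightarrow> real \<Rightarrow> real \<Rightarrow> real" where
  "mix_risk e m t = (1 - e) * shift_risk 0 t + e * shift_risk m t"

text \<open>The right-hand side is the limit for large thresholds. Lowering the threshold from
  infinity gains a first-order tail at \<open>t - m\<close> on the nonzero component, while the
  losses are a smaller second-order tail there and far smaller tails at \<open>t\<close> and
  \<open>t + m\<close>.\<close>

lemma mix_risk_le_limit:
  assumes "0 < e" "e \<le> 1" "0 < m"
  shows "\<exists>t\<ge>0. mix_risk e m t \<le> e * m\<^sup>2"
proof -
  \<comment> \<open>With this \<open>s\<close> the factor \<open>4 * s\<close> is
    \<open>m / 2\<close>, which gives \<open>2 * H \<le> m * G\<close>; the choice of
    \<open>a\<close> makes the decay factor \<open>exp (- (s * a))\<close> equal to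
    \<open>e / 4\<close>.\<close>
  define s where "s = m / 8"
  define a where "a = ln (4 / e) / s"
  have s: "0 < s" "s \<le> m" using assms by (auto simp: s_def)
  have a: "0 \<le> a" using assms s by (simp add: a_def)
  have exp_s: "exp (- (s * a)) = e / 4"
    using s assms by (simp add: a_def exp_minus)
  have "s * a \<le> m * a" using s a by (intro mult_right_mono)
  then have exp_m: "exp (- (m * a)) \<le> e / 4" using exp_s by (metis exp_le_cancel_iff neg_le_iff_le)
  define t where "t = a + m"
  have t: "0 \<le> t" "t - m = a" using a assms by (auto simp: t_def)
  define H where "H = gauss_tail 2 a"
  define G where "G = gauss_tail 1 a"
  have far: "gauss_tail k t \<le> e / 4 * gauss_tail k a" "gauss_tail k (t + m) \<le> e / 4 * gauss_tail k a"
    if k: "k = 1 \<or> k = 2" for k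
  proof -
    show 1: "gauss_tail k t \<le> e / 4 * gauss_tail k a"
      using gauss_tail_shift_le[OF k, of m a] assms mult_right_mono[OF exp_m, of "gauss_tail k a"]
      by (simp add: t_def)
    have "gauss_tail k (t + m) \<le> exp (- (m * t)) * gauss_tail k t"
      using gauss_tail_shift_le[OF k, of m t] assms by simp
    also have "\<dots> \<le> 1 * gauss_tail k t"
      using assms t by (intro mult_right_mono) auto
    finally show "gauss_tail k (t + m) \<le> e / 4 * gauss_tail k a" using 1 by simp
  qed
  have small: "e / 4 * H \<le> H / 4" "e / 4 * G \<le> G / 4"
    using assms by (auto simp: H_def G_def mult_left_le_one_le)
  have HG: "2 * H \<le> m * G"
    using gauss_tail_2_le_1[of s a] s assms exp_s by (simp add: H_def G_def s_def)
  \<comment> \<open>The factor \<open>e\<close> in the tail at \<open>t\<close> lets the loss on the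
    zero component be compared with the gain, which carries the weight \<open>e\<close>.\<close>
  have "(1 - e) * shift_risk 0 t \<le> shift_risk 0 t"
    using assms by (intro mult_left_le_one_le) auto
  also have "\<dots> = 2 * gauss_tail 2 t" using shift_risk_eq_gauss_tail[OF t(1), of 0] by simp
  also have "\<dots> \<le> e * (H / 2)" using far(1)[of 2] by (simp add: H_def)
  finally have 1: "(1 - e) * shift_risk 0 t \<le> e * (H / 2)" .
  have "m * gauss_tail 1 (t + m) \<le> m * (G / 4)"
    using far(2)[of 1] small assms by (intro mult_left_mono) (auto simp: G_def)
  then have "shift_risk m t \<le> m\<^sup>2 + H + H / 4 - 2 * (m * G) + m * G / 2"
    unfolding shift_risk_eq_gauss_tail[OF t(1)] t(2)
    using far(2)[of 2] small by (simp add: H_def G_def)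
  then have "e * shift_risk m t \<le> e * (m\<^sup>2 + H + H / 4 - 2 * (m * G) + m * G / 2)"
    using assms by (intro mult_left_mono) auto
  with 1 have "mix_risk e m t \<le> e * (m\<^sup>2 + H + H / 4 - 2 * (m * G) + m * G / 2 + H / 2)"
    unfolding mix_risk_def distrib_left[of e _ "H / 2"] by linarith
  \<comment> \<open>The coefficients add up to \<open>7 / 4\<close> for \<open>H\<close> and
    \<open>- 3 / 2\<close> for \<open>m * G\<close>, and \<open>7 / 4 * H\<close> is at most
    \<open>7 / 8 * (m * G)\<close>.\<close>
  also have "\<dots> \<le> e * m\<^sup>2"
  proof (rule mult_left_mono)
    have "0 \<le> H" "0 \<le> m * G" using assms by (auto simp: H_def G_def)
    then show "m\<^sup>2 + H + H / 4 - 2 * (m * G) + m * G / 2 + H / 2 \<le> m\<^sup>2" using HG by linarith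
  qed (use assms in simp)
  finally show ?thesis using t by blast
qed

lemma mix_risk_tendsto_top: "((\<lambda>t. mix_risk e m t) \<longlongrightarrow> e * m\<^sup>2) at_top"
  unfolding mix_risk_def
  by (rule tendsto_eq_intros shift_risk_tendsto_top refl)+ simp

lemma mix_risk_tendsto:
  assumes "\<And>n. 0 \<le> t n" "t \<longlonglongrightarrow> t0"
  shows "(\<lambda>n. mix_risk e m (t n)) \<longlonglongrightarrow> mix_risk e m t0"
  unfolding mix_risk_def by (intro tendsto_intros shift_risk_tendsto_threshold assms)

lemma continuous_on_mix_risk: "continuous_on {0..} (mix_risk e m)"
  by (rule continuous_on_sequentiallyI) (auto intro: mix_risk_tendsto)

lemma mix_risk_mono:
  assumes "0 \<le> e" "0 \<le> t" "0 \<le> m" "m \<le> n" shows "mix_risk e m t \<le> mix_risk e n t"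
  unfolding mix_risk_def
  using shift_risk_mono[OF assms(2-4), of 1] assms(1) by (simp add: mult_left_mono)

text \<open>Either \<open>t0\<close> is already a minimizer, or some value lies strictly below the
  limit, and then the search reduces to a compact interval.\<close>

lemma attains_inf_at_least:
  fixes f :: "real \<Rightarrow> real"
  assumes cont: "continuous_on {0..} f" and lim: "(f \<longlongrightarrow> L) at_top" and t0: "0 \<le> t0" "f t0 \<le> L"
  shows "\<exists>t\<ge>0. \<forall>u\<ge>0. f t \<le> f u"
proof (cases "\<forall>u\<ge>0. f t0 \<le> f u")
  case True
  then show ?thesis using t0 by blast
next
  case False
  then obtain v where v: "0 \<le> v" "f v < L" using t0 by force
  then have "\<forall>\<^sub>F u in at_top. f v < f u" using lim order_tendstoD(1) by blast
  then obtain B where B: "\<And>u. B \<le> u \<Longrightarrow> f v < f u" unfolding eventually_at_top_linorder by blast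
  have "continuous_on {0..max v B} f" using cont by (rule continuous_on_subset) auto
  then obtain t where t: "t \<in> {0..max v B}" "\<And>u. u \<in> {0..max v B} \<Longrightarrow> f t \<le> f u"
    using continuous_attains_inf[of "{0..max v B}" f] v
    by (metis atLeastatMost_empty_iff2 compact_Icc max.coboundedI1 not_le)
  have "f t \<le> f u" if "0 \<le> u" for u
  proof (cases "u \<le> max v B")
    case True
    then show ?thesis using that t(2) by simp
  next
    case False
    then have "f v < f u" using B by simp
    moreover have "f t \<le> f v" using t(2)[of v] v by simp
    ultimately show ?thesis by simp
  qed
  then show ?thesis using t by auto
qed

text \<open>All the mass allowed off zero sits at 1; after division by \<sigma> this point moves to
  infinity as \<sigma> tends to 0, the worst case in \<open>M1\<close>.\<close>

definition two_point :: "real \<Rightarrow> real measure" where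
  "two_point e = distr (measure_pmf (bernoulli_pmf e)) borel of_bool"

lemma integral_two_point:
  fixes f :: "real \<Rightarrow> real"
  assumes "0 \<le> e" "e \<le> 1" and [measurable]: "f \<in> borel_measurable borel"
  shows "(\<integral>x. f x \<partial>two_point e) = (1 - e) * f 0 + e * f 1"
  using assms by (simp add: two_point_def integral_distr algebra_simps)

lemma signal_two_point: "signal (two_point e)"
proof -
  interpret real_distribution "two_point e"
    unfolding two_point_def by (rule prob_space.real_distribution_distr[OF prob_space_measure_pmf]) simp
  show ?thesis
  proof
    show "integrable (two_point e) (\<lambda>x. x\<^sup>2)"
      unfolding two_point_def
      by (subst integrable_distr_eq) (auto intro!: measure_pmf.integrable_const_bound[of _ 1])
  qed
qed

lemma two_point_in_sparse_dists:
  assumes "0 \<le> e" "e \<le> 1" shows "two_point e \<in> sparse_dists e"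
proof -
  interpret signal "two_point e" by (rule signal_two_point)
  have "measure (two_point e) {0} = (\<integral>x. indicator {0} x \<partial>two_point e)" by simp
  also have "\<dots> = 1 - e" using assms by (subst integral_two_point) auto
  finally show ?thesis
    by (simp add: sparse_dists_def real_distribution_axioms)
qed

lemma risk_two_point:
  assumes "0 \<le> e" "e \<le> 1" "0 < s" "0 \<le> l"
  shows "risk (two_point e) s l = s\<^sup>2 * mix_risk e (1 / s) (l / s)"
proof -
  interpret signal "two_point e" by (rule signal_two_point)
  have "(\<lambda>x. shift_risk (1 / s * x) (l / s)) \<in> borel_measurable (two_point e)"
    using integrable_shift_risk[of "l / s" "1 / s"] assms by (intro borel_measurable_integrable) auto
  then have "(\<lambda>x. shift_risk (1 / s * x) (l / s)) \<in> borel_measurable borel" by simp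
  then have "scaled_risk (1 / s) (l / s) = mix_risk e (1 / s) (l / s)"
    unfolding scaled_risk_def by (subst integral_two_point[OF assms(1,2)]) (auto simp: mix_risk_def)
  then show ?thesis using risk_eq[OF assms(3,4)] by simp
qed

text \<open>Without this, a statement about all optimal policies could hold vacuously for the
  two-point signal.\<close>

lemma ex_optimal_policy_two_point:
  assumes "0 < e" "e \<le> 1" shows "\<exists>lam. optimal_policy (two_point e) lam"
proof -
  interpret signal "two_point e" by (rule signal_two_point)
  have "\<exists>l. is_arg_min (risk (two_point e) s) (\<lambda>l. 0 \<le> l) l" if "0 \<le> s" for s
  proof (cases "s = 0")
    case True
    have "risk (two_point e) 0 0 = 0" by (simp add: risk_def case_prod_unfold)
    then show ?thesis
      using True risk_nonneg by (intro exI[of _ 0]) (simp add: is_arg_min_def not_less)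
  next
    case False
    then have s: "0 < s" using that by simp
    obtain t0 where "0 \<le> t0" "mix_risk e (1 / s) t0 \<le> e * (1 / s)\<^sup>2"
      using mix_risk_le_limit[OF assms, of "1 / s"] s by auto
    then obtain t where t: "0 \<le> t" "\<And>u. 0 \<le> u \<Longrightarrow> mix_risk e (1 / s) t \<le> mix_risk e (1 / s) u"
      using attains_inf_at_least[OF continuous_on_mix_risk mix_risk_tendsto_top] by metis
    have "risk (two_point e) s (s * t) \<le> risk (two_point e) s l" if "0 \<le> l" for l
      using t(1) t(2)[of "l / s"] s that assms by (simp add: risk_two_point)
    then show ?thesis
      using t s by (intro exI[of _ "s * t"]) (simp add: is_arg_min_def not_less)
  qed
  then show ?thesis unfolding optimal_policy_def by metis
qed

text \<open>Compactness: thresholds violating the bound for every \<open>n\<close> stay bounded, and an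
  accumulation point violates the hypothesis.\<close>

lemma mix_risk_uniform_lower_bound:
  assumes e: "0 < e" "e \<le> 1"
    and d: "\<And>t. 0 \<le> t \<Longrightarrow> d < (1 - e) * shift_risk 0 t + e * (1 + t\<^sup>2)"
  shows "\<exists>n::nat. 0 < n \<and> (\<forall>t\<ge>0. d \<le> mix_risk e (real n) t)"
proof (rule ccontr)
  assume "\<not> ?thesis"
  then have "\<forall>n. \<exists>t\<ge>0. mix_risk e (real (Suc n)) t < d" by (meson not_less zero_less_Suc)
  then obtain t where t: "\<And>n. 0 \<le> t n" "\<And>n. mix_risk e (real (Suc n)) (t n) < d" by metis
  have below: "mix_risk e (real k) (t n) < d" if "k \<le> Suc n" for k n
    using mix_risk_mono[of e "t n" "real k" "real (Suc n)"] t[of n] e that by simp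
  \<comment> \<open>For this \<open>k\<close> the limit \<open>e * (real k)\<^sup>2\<close> at large
    thresholds exceeds \<open>d\<close>, which confines the offending thresholds to a bounded
    interval.\<close>
  obtain k where k: "max 1 (d / e) < real k" using reals_Archimedean2 by blast
  then have "real k < real k ^ 2" by (simp add: power2_eq_square)
  then have "d / e < real k ^ 2" using k by linarith
  then have "d < e * (real k)\<^sup>2" using e by (simp add: divide_less_eq mult.commute)
  then have "\<forall>\<^sub>F u in at_top. d < mix_risk e (real k) u"
    using mix_risk_tendsto_top order_tendstoD(1) by blast
  then obtain B where B: "\<And>u. B \<le> u \<Longrightarrow> d < mix_risk e (real k) u"
    unfolding eventually_at_top_linorder by blast
  have "t (n + k) \<in> {0..B}" for n
    using t(1)[of "n + k"] below[of k "n + k"] B[of "t (n + k)"] by (cases "B \<le> t (n + k)") auto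
  then obtain t0 r where r: "t0 \<in> {0..B}" "strict_mono r" "((\<lambda>n. t (n + k)) \<circ> r) \<longlonglongrightarrow> t0"
    using compact_Icc[of 0 B] unfolding compact_def by metis
  \<comment> \<open>For fixed \<open>j\<close> the indices along the subsequence eventually exceed
    \<open>j\<close>, and monotonicity in the signal transfers the bound to \<open>j\<close>.
    Afterwards \<open>j\<close> tends to infinity.\<close>
  have "mix_risk e (real j) t0 \<le> d" for j
  proof (rule LIMSEQ_le_const2)
    show "(\<lambda>n. mix_risk e (real j) (t (r n + k))) \<longlonglongrightarrow> mix_risk e (real j) t0"
      using r(3) t(1) by (intro mix_risk_tendsto) (auto simp: comp_def)
    show "\<exists>N. \<forall>n\<ge>N. mix_risk e (real j) (t (r n + k)) \<le> d"
    proof (intro exI allI impI)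
      fix n assume "j \<le> n"
      then have "j \<le> Suc (r n + k)" using seq_suble[OF r(2), of n] by simp
      then show "mix_risk e (real j) (t (r n + k)) \<le> d" using below by (simp add: less_imp_le)
    qed
  qed
  moreover have "(\<lambda>j. mix_risk e (real j) t0) \<longlonglongrightarrow> (1 - e) * shift_risk 0 t0 + e * (1 + t0\<^sup>2)"
    unfolding mix_risk_def using r(1) by (intro tendsto_intros shift_risk_tendsto) auto
  ultimately have "(1 - e) * shift_risk 0 t0 + e * (1 + t0\<^sup>2) \<le> d"
    by (intro LIMSEQ_le_const2) auto
  then show False using d[of t0] r(1) by simp
qed

subsection \<open>The threshold \<open>M1\<close>\<close>

text \<open>The upper bound valid for every \<open>m\<close> is also the limit along the natural
  numbers.\<close>

lemma SUP_mix_risk: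
  assumes "0 \<le> e" "0 \<le> t"
  shows "(SUP m\<in>{0..}. mix_risk e m t) = (1 - e) * shift_risk 0 t + e * (1 + t\<^sup>2)"
proof (rule antisym)
  have le: "mix_risk e m t \<le> (1 - e) * shift_risk 0 t + e * (1 + t\<^sup>2)" for m
    unfolding mix_risk_def using shift_risk_le[OF assms(2)] assms(1)
    by (intro add_left_mono mult_left_mono)
  then show "(SUP m\<in>{0..}. mix_risk e m t) \<le> (1 - e) * shift_risk 0 t + e * (1 + t\<^sup>2)"
    by (intro cSUP_least) auto
  show "(1 - e) * shift_risk 0 t + e * (1 + t\<^sup>2) \<le> (SUP m\<in>{0..}. mix_risk e m t)"
  proof (rule LIMSEQ_le_const2)
    show "(\<lambda>n. mix_risk e (real n) t) \<longlonglongrightarrow> (1 - e) * shift_risk 0 t + e * (1 + t\<^sup>2)"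
      unfolding mix_risk_def by (intro tendsto_intros shift_risk_tendsto assms)
    show "\<exists>N. \<forall>n\<ge>N. mix_risk e (real n) t \<le> (SUP m\<in>{0..}. mix_risk e m t)"
      using le by (intro exI[of _ 0] allI impI cSUP_upper bdd_aboveI2) auto
  qed
qed

lemma M1_eq:
  assumes "0 \<le> e"
  shows "M1 e = (INF t\<in>{0..}. (1 - e) * shift_risk 0 t + e * (1 + t\<^sup>2))"
proof -
  have "M1 e = (INF t\<in>{0..}. SUP m\<in>{0..}. mix_risk e m t)"
    by (simp add: M1_def mix_risk_def shift_risk_def)
  also have "\<dots> = (INF t\<in>{0..}. (1 - e) * shift_risk 0 t + e * (1 + t\<^sup>2))"
    using SUP_mix_risk[OF assms] by (intro INF_cong) auto
  finally show ?thesis .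
qed

lemma M1_le:
  assumes "0 \<le> e" "e \<le> 1" "0 \<le> t"
  shows "M1 e \<le> (1 - e) * shift_risk 0 t + e * (1 + t\<^sup>2)"
  unfolding M1_eq[OF assms(1)]
  using assms by (intro cINF_lower bdd_belowI2[of _ 0]) auto

lemma M1_lessD:
  assumes "0 \<le> e" "M1 e < d"
  obtains t where "0 \<le> t" "(1 - e) * shift_risk 0 t + e * (1 + t\<^sup>2) < d"
proof -
  have "Inf ((\<lambda>t. (1 - e) * shift_risk 0 t + e * (1 + t\<^sup>2)) ` {0..}) < d"
    using assms M1_eq by simp
  from cInf_lessD[OF _ this] show thesis using that by auto
qed

text \<open>With no mass off zero, raising the threshold drives the risk to 0.\<close>

lemma M1_zero: "M1 0 \<le> 0"
proof (rule tendsto_lowerbound)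
  show "((\<lambda>t. shift_risk 0 t) \<longlongrightarrow> 0) at_top" using shift_risk_tendsto_top[of 0] by simp
  show "\<forall>\<^sub>F t in at_top. M1 0 \<le> shift_risk 0 t"
    using eventually_ge_at_top[of 0] by eventually_elim (use M1_le[of 0] in simp)
qed simp

section \<open>Stability of zero compared with the value of \<open>M1\<close>\<close>

lemma optimal_signalI:
  assumes "p \<in> sparse_dists e" "finite_second_moment p" "optimal_policy p lam"
  shows "optimal_signal p lam"
  using assms
  by (simp add: sparse_dists_def finite_second_moment_def optimal_signal_def signal_def
      signal_axioms_def optimal_signal_axioms_def)

text \<open>The equivalence quantifies over the whole class of signals: sufficiency needs one
  normalized threshold good for all of them, necessity a single bad signal.\<close>

theorem proposition2:
  fixes \<delta> \<epsilon> :: real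
  assumes "0 < \<delta>" "\<delta> < 1" and "0 \<le> \<epsilon>" "\<epsilon> \<le> 1"
  shows
    "(\<forall>\<sigma>w\<ge>0. \<forall>p\<in>sparse_dists \<epsilon>. \<forall>lam.
        finite_second_moment p \<longrightarrow> optimal_policy p lam \<longrightarrow>
        (\<exists>!s. stable_fixed_point (state_evolution p \<sigma>w \<delta> lam) s))
   \<and> (\<delta> \<noteq> M1 \<epsilon> \<longrightarrow>
        ((\<forall>p\<in>sparse_dists \<epsilon>. \<forall>lam.
            finite_second_moment p \<longrightarrow> optimal_policy p lam \<longrightarrow>
            (\<forall>s. stable_fixed_point (state_evolution p 0 \<delta> lam) s \<longleftrightarrow> s = 0))
         \<longleftrightarrow> \<delta> > M1 \<epsilon>))
   \<and> M1 \<epsilon> = (INF \<tau>\<in>{0..}.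
        (1 - \<epsilon>) * (\<integral>z. (soft_threshold z \<tau>)\<^sup>2 \<partial>std_normal_distribution)
        + \<epsilon> * (1 + \<tau>\<^sup>2))"
proof (intro conjI impI)
  have unique: "\<exists>!s. stable_fixed_point (state_evolution p w \<delta> lam) s"
    if "p \<in> sparse_dists \<epsilon>" "finite_second_moment p" "optimal_policy p lam" for p lam w
  proof -
    interpret optimal_signal p lam using that by (rule optimal_signalI)
    interpret unique_crossing "state_evolution p w \<delta> lam" "\<lambda>s. w\<^sup>2 / s\<^sup>2 + min_risk s / s\<^sup>2 / \<delta>"
      by (rule unique_crossing_state_evolution) fact+
    show ?thesis by (rule ex1_stable)
  qed
  then show "\<forall>\<sigma>w\<ge>0. \<forall>p\<in>sparse_dists \<epsilon>. \<forall>lam.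
        finite_second_moment p \<longrightarrow> optimal_policy p lam \<longrightarrow>
        (\<exists>!s. stable_fixed_point (state_evolution p \<sigma>w \<delta> lam) s)"
    by blast
  show "M1 \<epsilon> = (INF \<tau>\<in>{0..}.
        (1 - \<epsilon>) * (\<integral>z. (soft_threshold z \<tau>)\<^sup>2 \<partial>std_normal_distribution)
        + \<epsilon> * (1 + \<tau>\<^sup>2))"
    using M1_eq[OF assms(3)] by (simp add: shift_risk_def)
  assume "\<delta> \<noteq> M1 \<epsilon>"
  have zero_iff: "stable_fixed_point (state_evolution p 0 \<delta> lam) 0
      \<longleftrightarrow> (\<forall>s>0. risk p s (lam s) < \<delta> * s\<^sup>2)"
    if "p \<in> sparse_dists \<epsilon>" "finite_second_moment p" "optimal_policy p lam" for p lam
  proof -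
    interpret optimal_signal p lam using that by (rule optimal_signalI)
    interpret unique_crossing "state_evolution p 0 \<delta> lam" "\<lambda>s. 0\<^sup>2 / s\<^sup>2 + min_risk s / s\<^sup>2 / \<delta>"
      by (rule unique_crossing_state_evolution) fact+
    have "state_evolution p 0 \<delta> lam 0 = 0"
      using state_evolution_eq[of 0 0 \<delta>] min_risk_zero by simp
    then show ?thesis
      unfolding stable_zero_iff using assms(1) by (auto simp: min_risk_def divide_less_eq mult.commute)
  qed
  show "(\<forall>p\<in>sparse_dists \<epsilon>. \<forall>lam.
            finite_second_moment p \<longrightarrow> optimal_policy p lam \<longrightarrow>
            (\<forall>s. stable_fixed_point (state_evolution p 0 \<delta> lam) s \<longleftrightarrow> s = 0))
         \<longleftrightarrow> \<delta> > M1 \<epsilon>"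
  proof
    assume all: "\<forall>p\<in>sparse_dists \<epsilon>. \<forall>lam.
            finite_second_moment p \<longrightarrow> optimal_policy p lam \<longrightarrow>
            (\<forall>s. stable_fixed_point (state_evolution p 0 \<delta> lam) s \<longleftrightarrow> s = 0)"
    show "\<delta> > M1 \<epsilon>"
    proof (rule ccontr)
      assume "\<not> \<delta> > M1 \<epsilon>"
      then have less: "\<delta> < M1 \<epsilon>" using \<open>\<delta> \<noteq> M1 \<epsilon>\<close> by simp
      \<comment> \<open>\<open>M1 0\<close> is at most 0 and hence below \<delta>.\<close>
      then have "0 < \<epsilon>" using M1_zero assms by (cases "\<epsilon> = 0") auto
      then obtain lam where lam: "optimal_policy (two_point \<epsilon>) lam"
        using ex_optimal_policy_two_point assms by blast
      interpret optimal_signal "two_point \<epsilon>" lam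
        using signal_two_point lam by (simp add: optimal_signal_def optimal_signal_axioms_def)
      have two: "two_point \<epsilon> \<in> sparse_dists \<epsilon>" "finite_second_moment (two_point \<epsilon>)"
        using two_point_in_sparse_dists assms second_moment by (auto simp: finite_second_moment_def)
      obtain n where n: "0 < n" "\<And>t. 0 \<le> t \<Longrightarrow> \<delta> \<le> mix_risk \<epsilon> (real n) t"
        using mix_risk_uniform_lower_bound[OF \<open>0 < \<epsilon>\<close> assms(4), of \<delta>] M1_le[OF assms(3,4)] less
        by (metis order_less_le_trans)
      \<comment> \<open>At this noise level the nonzero value of the scaled signal is
        \<open>real n\<close>.\<close>
      define s where "s = 1 / real n"
      have s: "0 < s" "1 / s = real n" using n by (auto simp: s_def)
      have "\<delta> * s\<^sup>2 \<le> risk (two_point \<epsilon>) s (lam s)"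
        using n(2)[of "lam s / s"] s lam_nonneg[of s] assms
        by (simp add: risk_two_point mult.commute mult_left_mono)
      then have "\<not> stable_fixed_point (state_evolution (two_point \<epsilon>) 0 \<delta> lam) 0"
        using zero_iff[OF two lam] s by (meson not_less)
      then show False using all two lam by blast
    qed
  next
    assume "M1 \<epsilon> < \<delta>"
    then obtain t where t: "0 \<le> t" "(1 - \<epsilon>) * shift_risk 0 t + \<epsilon> * (1 + t\<^sup>2) < \<delta>"
      using M1_lessD assms by blast
    show "\<forall>p\<in>sparse_dists \<epsilon>. \<forall>lam.
            finite_second_moment p \<longrightarrow> optimal_policy p lam \<longrightarrow>
            (\<forall>s. stable_fixed_point (state_evolution p 0 \<delta> lam) s \<longleftrightarrow> s = 0)"
    proof (intro ballI allI impI)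
      fix p lam s
      assume p: "p \<in> sparse_dists \<epsilon>" "finite_second_moment p" "optimal_policy p lam"
      interpret optimal_signal p lam using p by (rule optimal_signalI)
      have "risk p s (lam s) < \<delta> * s\<^sup>2" if "0 < s" for s
      proof -
        \<comment> \<open>The same normalized threshold \<open>t\<close> serves at every noise
          level.\<close>
        have "risk p s (lam s) \<le> risk p s (s * t)"
          using min_risk_le[of s "s * t"] that t by (simp add: min_risk_def)
        also have "\<dots> = s\<^sup>2 * scaled_risk (1 / s) t"
          using risk_eq[of s "s * t"] that t by simp
        also have "\<dots> < s\<^sup>2 * \<delta>"
          using scaled_risk_le[OF t(1), of \<epsilon> "1 / s"] p(1) t(2) that
          by (intro mult_strict_left_mono) (auto simp: sparse_dists_def)
        finally show ?thesis by (simp add: mult.commute)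
      qed
      then have "stable_fixed_point (state_evolution p 0 \<delta> lam) 0"
        using zero_iff[OF p] by simp
      \<comment> \<open>Uniqueness from the first part excludes every other stable point.\<close>
      then show "stable_fixed_point (state_evolution p 0 \<delta> lam) s \<longleftrightarrow> s = 0"
        using unique[OF p] by blast
    qed
  qed
qed

end
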